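(* Let $(\mathcal V,d,\mu)$ be the weighted homogeneous tree of order $q+1$ and let $H^1(\mu)$ be the atomic Hardy space on it, as defined in the context. Let $T$ be a linear operator which is bounded on $L^2(\mu)$ and admits a locally integrable kernel $K$ off the diagonal that satisfies $$\sup_{\tilde R}\ \sup_{y,z\in\tilde R}\int_{(\tilde R^* )^c}|K(x,y)-K(x,z)|\,d\mu(x)<\infty,$$ where the first supremum is taken over all Calderón–Zygmund sets $\tilde R$. Then $T$ extends to a bounded operator from $H^1(\mu)$ to $L^1(\mu)$.
   Context: Weighted tree. Fix an integer $q\ge 2$. $\mathcal V$ is the vertex set of the infinite homogeneous tree of order $q+1$, i.e. the connected acyclic graph in which every vertex has exactly $q+1$ neighbours; $d$ is the graph distance. Fix a doubly-infinite geodesic $g\subset\mathcal V$ (a connected subset in which every element has exactly two neighbours belonging to $g$ and which contains the shortest path between any two of its elements) and a map $N:g\to\mathbb Z$ with $|N(x)-N(y)|=d(x,y)$ for all $x,y\in g$. The level function $\ell:\mathcal V\to\mathbb Z$ is $\ell(x)=N(x')-d(x,x')$, where $x'$ is the unique vertex of $g$ closest to $x$. The measure $\mu$ on $\mathcal V$ is $\int_{\mathcal V}f\,d\mu=\sum_{x\in\mathcal V}f(x)q^{\ell(x)}$. A vertex $x$ lies below a vertex $y$ if $\ell(x)=\ell(y)-d(x,y)$. Calderón–Zygmund sets. An admissible trapezoid is a set $R\subset\mathcal V$ that is either a single vertex $R=\{x_R\}$ (degenerate case; put $h(R)=1$), or of the form $R=\{x\in\mathcal V: x\text{ lies below }x_R,\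 h\le \ell(x_R)-\ell(x)<2h\}$ for some $x_R\in\mathcal V$ and some integer $h\ge1$ (put $h(R)=h$). The envelope of $R$ is $\tilde R=\{x\in\mathcal V: x\text{ lies below }x_R,\ \tfrac h2\le \ell(x_R)-\ell(x)<4h\}$ in the nondegenerate case, and $\tilde R=R$ in the degenerate case; put $h(\tilde R)=h(R)$. A Calderón–Zygmund set is the envelope of an admissible trapezoid. For a Calderón–Zygmund set $\tilde R$, $\tilde R^*=\{x\in\mathcal V: d(x,\tilde R)<h(\tilde R)/4\}$. Hardy space. A $(1,\infty)$-atom is a function $a:\mathcal V\to\mathbb C$ such that: $a$ is supported in a Calderón–Zygmund set $\tilde R$; $\|a\|_{L^\infty}\le\mu(\tilde R)^{-1}$; and $\int_{\mathcal V}a\,d\mu=0$. $H^1(\mu)=H^{1,\infty}(\mu)$ is the space of all $h\in L^1(\mu)$ of the form $h=\sum_j\lambda_ja_j$ (convergence in $L^1(\mu)$) with $a_j$ $(1,\infty)$-atoms and $\lambda_j\in\mathbb C$, $\sum_j|\lambda_j|<\infty$; $\|h\|_{H^1}$ is the infimum of $\sum_j|\lambda_j|$ over all such decompositions. Kernel. That $T$ admits the kernel $K$ off the diagonal means that $Tf(x)=\int_{\mathcal V}K(x,y)f(y)\,d\mu(y)$ for every finitely supported $f$ and every $x$ outside the support of $f$. *)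

theory Defs
  imports "HOL-Analysis.Analysis"
begin

definition walk :: "('v \<Rightarrow> 'v \<Rightarrow> bool) \<Rightarrow> 'v \<Rightarrow> 'v list \<Rightarrow> 'v \<Rightarrow> bool" where
  "walk E x xs y \<longleftrightarrow> xs \<noteq> [] \<and> hd xs = x \<and> last xs = y \<and> successively E xs"

definition gdist :: "('v \<Rightarrow> 'v \<Rightarrow> bool) \<Rightarrow> 'v \<Rightarrow> 'v \<Rightarrow> nat" where
  "gdist E x y = (LEAST n. \<exists>xs. walk E x xs y \<and> length xs = Suc n)"

definition graph_cycle :: "('v \<Rightarrow> 'v \<Rightarrow> bool) \<Rightarrow> 'v list \<Rightarrow> bool" where
  "graph_cycle E xs \<longleftrightarrow>
     length xs \<ge> 3 \<and> distinct xs \<and> successively E xs \<and> E (last xs) (hd xs)"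

text \<open>The vertex set is the whole type. Since \<open>card\<close> is 0 on infinite sets, the last
  condition makes every neighbourhood finite.\<close>

definition homogeneous_tree :: "('v \<Rightarrow> 'v \<Rightarrow> bool) \<Rightarrow> nat \<Rightarrow> bool" where
  "homogeneous_tree E q \<longleftrightarrow>
     symp E \<and> irreflp E \<and>
     (\<forall>x y. \<exists>xs. walk E x xs y) \<and>
     (\<nexists>xs. graph_cycle E xs) \<and>
     (\<forall>x. card {y. E x y} = q + 1)"

definition doubly_infinite_geodesic :: "('v \<Rightarrow> 'v \<Rightarrow> bool) \<Rightarrow> 'v set \<Rightarrow> bool" where
  "doubly_infinite_geodesic E g \<longleftrightarrow>
     g \<noteq> {} \<and>
     (\<forall>x\<in>g. \<forall>y\<in>g. \<exists>xs. walk E x xs y \<and> set xs \<subseteq> g) \<and>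
     (\<forall>x\<in>g. card {y\<in>g. E x y} = 2) \<and>
     (\<forall>x\<in>g. \<forall>y\<in>g. \<forall>xs. walk E x xs y \<and> length xs = Suc (gdist E x y) \<longrightarrow> set xs \<subseteq> g)"

text \<open>Elements of the Lebesgue spaces are functions rather than classes of functions.
  For the measure \<open>\<mu>\<close> on a tree defined below nothing is lost, since every
  point has positive mass and so the only null set is the empty one.\<close>

definition L1_space :: "'v measure \<Rightarrow> ('v \<Rightarrow> complex) set" where
  "L1_space M = {f. integrable M f}"

definition L1_norm :: "'v measure \<Rightarrow> ('v \<Rightarrow> complex) \<Rightarrow> real" where
  "L1_norm M f = (\<integral>x. cmod (f x) \<partial>M)"

definition L2_space :: "'v measure \<Rightarrow> ('v \<Rightarrow> complex) set" where
  "L2_space M = {f \<in> borel_measurable M. integrable M (\<lambda>x. (cmod (f x))\<^sup>2)}"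

definition L2_norm :: "'v measure \<Rightarrow> ('v \<Rightarrow> complex) \<Rightarrow> real" where
  "L2_norm M f = sqrt (\<integral>x. (cmod (f x))\<^sup>2 \<partial>M)"

text \<open>Only the values of \<open>T\<close> on \<open>X\<close> matter.\<close>

definition bounded_operator ::
  "('v \<Rightarrow> complex) set \<Rightarrow> (('v \<Rightarrow> complex) \<Rightarrow> real) \<Rightarrow>
   ('v \<Rightarrow> complex) set \<Rightarrow> (('v \<Rightarrow> complex) \<Rightarrow> real) \<Rightarrow>
   (('v \<Rightarrow> complex) \<Rightarrow> ('v \<Rightarrow> complex)) \<Rightarrow> bool" where
  "bounded_operator X normX Y normY T \<longleftrightarrow>
     (\<forall>f\<in>X. T f \<in> Y) \<and>
     (\<forall>f\<in>X. \<forall>f'\<in>X. T (\<lambda>x. f x + f' x) = (\<lambda>x. T f x + T f' x)) \<and>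
     (\<forall>c. \<forall>f\<in>X. T (\<lambda>x. c * f x) = (\<lambda>x. c * T f x)) \<and>
     (\<exists>C. \<forall>f\<in>X. normY (T f) \<le> C * normX f)"

text \<open>On a discrete space the compact sets avoiding the diagonal are the finite ones.\<close>

definition locally_integrable_off_diagonal ::
  "'v measure \<Rightarrow> ('v \<Rightarrow> 'v \<Rightarrow> complex) \<Rightarrow> bool" where
  "locally_integrable_off_diagonal M K \<longleftrightarrow>
     (\<forall>C. finite C \<and> C \<inter> Id = {} \<longrightarrow> set_integrable (M \<Otimes>\<^sub>M M) C (\<lambda>(x, y). K x y))"

definition admits_kernel_off_diagonal ::
  "'v measure \<Rightarrow> (('v \<Rightarrow> complex) \<Rightarrow> ('v \<Rightarrow> complex)) \<Rightarrow> ('v \<Rightarrow> 'v \<Rightarrow> complex) \<Rightarrow> bool" where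
  "admits_kernel_off_diagonal M T K \<longleftrightarrow>
     (\<forall>f. finite {y. f y \<noteq> 0} \<longrightarrow>
       (\<forall>x. x \<notin> {y. f y \<noteq> 0} \<longrightarrow> T f x = (\<integral>y. K x y * f y \<partial>M)))"

text \<open>\<open>Trapezoid x h\<close> is the nondegenerate trapezoid with top vertex \<open>x\<close> and
  height \<open>h\<close>. Carrying these data instead of the bare vertex set makes the height and
  the envelope functions of the trapezoid.\<close>

datatype 'v trapezoid = Degenerate 'v | Trapezoid 'v nat

primrec admissible :: "'v trapezoid \<Rightarrow> bool" where
  "admissible (Degenerate x) \<longleftrightarrow> True"
| "admissible (Trapezoid x h) \<longleftrightarrow> h \<ge> 1"

primrec height :: "'v trapezoid \<Rightarrow> nat" where
  "height (Degenerate x) = 1"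
| "height (Trapezoid x h) = h"

text \<open>The values of \<open>N\<close> outside \<open>g\<close> are irrelevant.\<close>

locale weighted_tree =
  fixes E :: "'v \<Rightarrow> 'v \<Rightarrow> bool" and q :: nat and g :: "'v set" and N :: "'v \<Rightarrow> int"
  assumes q_ge_2: "q \<ge> 2"
    and tree: "homogeneous_tree E q"
    and geodesic: "doubly_infinite_geodesic E g"
    and N_dist: "\<And>x y. x \<in> g \<Longrightarrow> y \<in> g \<Longrightarrow> \<bar>N x - N y\<bar> = int (gdist E x y)"
begin

definition proj :: "'v \<Rightarrow> 'v" where
  "proj x = (THE x'. x' \<in> g \<and> (\<forall>y\<in>g. gdist E x x' \<le> gdist E x y))"

definition level :: "'v \<Rightarrow> int" where
  "level x = N (proj x) - int (gdist E x (proj x))"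

definition \<mu> :: "'v measure" where
  "\<mu> = density (count_space UNIV) (\<lambda>x. ennreal (real q powi level x))"

definition below :: "'v \<Rightarrow> 'v \<Rightarrow> bool" where
  "below x y \<longleftrightarrow> level x = level y - int (gdist E x y)"

primrec trapezoid_set :: "'v trapezoid \<Rightarrow> 'v set" where
  "trapezoid_set (Degenerate z) = {z}"
| "trapezoid_set (Trapezoid z h) =
     {x. below x z \<and> int h \<le> level z - level x \<and> level z - level x < 2 * int h}"

primrec envelope :: "'v trapezoid \<Rightarrow> 'v set" where
  "envelope (Degenerate z) = {z}"
| "envelope (Trapezoid z h) =
     {x. below x z \<and> real h / 2 \<le> of_int (level z - level x) \<and>
         level z - level x < 4 * int h}"

definition enlargement :: "'v trapezoid \<Rightarrow> 'v set" where
  "enlargement R = {x. real (INF y\<in>envelope R. gdist E x y) < real (height R) / 4}"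

text \<open>The Calder\'on--Zygmund sets are the sets \<open>envelope R\<close> with \<open>R\<close> admissible.\<close>

definition atom :: "('v \<Rightarrow> complex) \<Rightarrow> bool" where
  "atom a \<longleftrightarrow>
     (\<exists>R. admissible R \<and>
       (\<forall>x. x \<notin> envelope R \<longrightarrow> a x = 0) \<and>
       (AE x in \<mu>. cmod (a x) \<le> 1 / measure \<mu> (envelope R)) \<and>
       (\<integral>x. a x \<partial>\<mu>) = 0)"

definition atomic_decomposition ::
  "('v \<Rightarrow> complex) \<Rightarrow> (nat \<Rightarrow> complex) \<Rightarrow> (nat \<Rightarrow> 'v \<Rightarrow> complex) \<Rightarrow> bool" where
  "atomic_decomposition f c a \<longleftrightarrow>
     (\<forall>j. atom (a j)) \<and> summable (\<lambda>j. cmod (c j)) \<and>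
     (\<lambda>n. L1_norm \<mu> (\<lambda>x. f x - (\<Sum>j<n. c j * a j x))) \<longlonglongrightarrow> 0"

definition H1_space :: "('v \<Rightarrow> complex) set" where
  "H1_space = {f \<in> L1_space \<mu>. \<exists>c a. atomic_decomposition f c a}"

definition H1_norm :: "('v \<Rightarrow> complex) \<Rightarrow> real" where
  "H1_norm f = Inf {(\<Sum>j. cmod (c j)) |c a. atomic_decomposition f c a}"

definition hoermander_sup :: "('v \<Rightarrow> 'v \<Rightarrow> complex) \<Rightarrow> ennreal" where
  "hoermander_sup K =
     (SUP R\<in>{R. admissible R}. SUP (y, z)\<in>envelope R \<times> envelope R.
        \<integral>\<^sup>+x\<in>- enlargement R. ennreal (cmod (K x y - K x z)) \<partial>\<mu>)"

end

end

theory Submission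
  imports Defs
begin

text \<open>
The difficulty is not to define an operator on \<open>H\<^sup>1\<close>, but to see that the sum of the
\<open>c j * T (a j)\<close> depends only on the function that is decomposed, and equals \<open>T f\<close> when this
function \<open>f\<close> is square integrable. The usual tool is a weak type (1,1) estimate, resting on
a Calderon-Zygmund decomposition. Here there is a shorter way, because points have positive mass.

The operator \<open>T\<close> has a matrix \<open>kernel x y\<close>, which coincides with \<open>K x y\<close> off the
diagonal. For fixed \<open>x\<close>, boundedness on \<open>L\<^sup>2\<close> makes the row \<open>kernel x\<close> square
integrable, and the integral condition, evaluated at the single point \<open>x\<close>, bounds the
oscillation of the row on every Calderon-Zygmund set whose enlargement misses \<open>x\<close>. Each
vertex lower than \<open>x\<close> lies in such a set whose mass is at least that of \<open>x\<close>, namely one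
headed by its ancestor at the level of \<open>x\<close>; on a set of that mass, square integrability provides
a point at which the row is controlled, and the oscillation bound spreads the control over the
set. Hence every row is bounded (lemma \<open>kernel_bounded\<close>).

With bounded rows the matrix acts on all of \<open>L\<^sup>1\<close>, turns convergence in
\<open>L\<^sup>1\<close> into pointwise convergence of the images, and agrees with \<open>T\<close> on the intersection of \<open>L\<^sup>1\<close> and
\<open>L\<^sup>2\<close> (lemma \<open>T_ext_eq\<close>). This is the extension; it is well defined and linear by
construction. What is left is the classical computation: images of atoms are uniformly bounded in
\<open>L\<^sup>1\<close> (lemma \<open>atom_image_bound\<close>), since enlargements have mass comparable to the
Calderon-Zygmund sets they come from (lemma \<open>measure_enlargement_le\<close>), and Fatou's lemma
passes from atoms to their sums (lemma \<open>T_ext_series_bound\<close>).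

The geometry is reduced to one fact, that every vertex has exactly one neighbour of higher
level, its parent (lemma \<open>ex1_upper_neighbour\<close>). It holds because, up to an additive constant,
the level is minus the distance to a point far up on the geodesic (lemma \<open>level_eq_Busemann\<close>).
\<close>

section \<open>Distances in a tree\<close>

lemma walk_length_iff_relpowp: "(\<exists>xs. walk E x xs y \<and> length xs = Suc n) \<longleftrightarrow> (E ^^ n) x y"
proof (induction n arbitrary: x)
  case 0
  show ?case
    by (auto simp: walk_def length_Suc_conv intro: exI[of _ "[x]"])
next
  case (Suc n)
  have "(\<exists>xs. walk E x xs y \<and> length xs = Suc (Suc n)) \<longleftrightarrow>
        (\<exists>z. E x z \<and> (\<exists>xs. walk E z xs y \<and> length xs = Suc n))"
  proof
    assume "\<exists>xs. walk E x xs y \<and> length xs = Suc (Suc n)"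
    then obtain a b xs where "walk E x (a # b # xs) y" "length xs = n"
      by (auto simp: length_Suc_conv)
    then have "E x b \<and> walk E b (b # xs) y \<and> length (b # xs) = Suc n"
      by (auto simp: walk_def)
    then show "\<exists>z. E x z \<and> (\<exists>xs. walk E z xs y \<and> length xs = Suc n)" by blast
  next
    assume "\<exists>z. E x z \<and> (\<exists>xs. walk E z xs y \<and> length xs = Suc n)"
    then obtain z xs where "E x z" "walk E z xs y" "length xs = Suc n" by blast
    then have "walk E x (x # xs) y \<and> length (x # xs) = Suc (Suc n)"
      by (cases xs) (auto simp: walk_def)
    then show "\<exists>xs. walk E x xs y \<and> length xs = Suc (Suc n)" by blast
  qed
  also have "\<dots> \<longleftrightarrow> (E ^^ Suc n) x y"
    unfolding Suc.IH by (meson relpowp_Suc_D2 relpowp_Suc_I2)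
  finally show ?case .
qed

lemma gdist_eq_Least_relpowp: "gdist E x y = (LEAST n. (E ^^ n) x y)"
  unfolding gdist_def walk_length_iff_relpowp ..

lemma rtranclp_distinct_path:
  assumes "R\<^sup>*\<^sup>* x y"
  shows "\<exists>xs. walk R x xs y \<and> distinct xs"
  using assms
proof (induction rule: converse_rtranclp_induct)
  case base
  have "walk R y [y] y \<and> distinct [y]" by (simp add: walk_def)
  then show ?case by blast
next
  case (step x z)
  then obtain xs where xs: "walk R z xs y" "distinct xs" by blast
  show ?case
  proof (cases "x \<in> set xs")
    case True
    then obtain ys zs where "xs = ys @ x # zs" by (meson split_list)
    with xs have "walk R x (x # zs) y \<and> distinct (x # zs)"
      by (auto simp: walk_def successively_append_iff)
    then show ?thesis by blast
  next
    case False
    with xs step have "walk R x (x # xs) y \<and> distinct (x # xs)"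
      by (cases xs) (auto simp: walk_def)
    then show ?thesis by blast
  qed
qed

locale tree_graph =
  fixes E :: "'v \<Rightarrow> 'v \<Rightarrow> bool"
  assumes symp_adj: "symp E" and irreflp_adj: "irreflp E"
    and connected: "\<exists>xs. walk E x xs y"
    and no_cycle: "\<not> graph_cycle E xs"
begin

abbreviation d :: "'v \<Rightarrow> 'v \<Rightarrow> nat" where "d \<equiv> gdist E"

lemma relpowp_gdist: "(E ^^ d x y) x y"
proof -
  obtain xs where "walk E x xs y" using connected by blast
  then have "\<exists>xs. walk E x xs y \<and> length xs = Suc (length xs - 1)"
    by (intro exI[of _ xs]) (auto simp: walk_def)
  then have "\<exists>n. (E ^^ n) x y"
    using walk_length_iff_relpowp by (metis Suc_pred length_greater_0_conv walk_def)
  then show ?thesis unfolding gdist_eq_Least_relpowp by (rule LeastI_ex)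
qed

lemma gdist_le: "(E ^^ n) x y \<Longrightarrow> d x y \<le> n"
  unfolding gdist_eq_Least_relpowp by (rule Least_le)

lemma gdist_eq_0_iff [simp]: "d x y = 0 \<longleftrightarrow> x = y"
  using relpowp_gdist[of x y] gdist_le[of 0 x y] by auto

lemma gdist_self [simp]: "d x x = 0"
  by simp

lemma relpowp_sym: "(E ^^ n) x y \<Longrightarrow> (E ^^ n) y x"
proof (induction n arbitrary: y)
  case (Suc n)
  then obtain z where "(E ^^ n) x z" "E z y" by auto
  with Suc.IH symp_adj show ?case by (meson relpowp_Suc_I2 sympD)
qed auto

lemma gdist_commute: "d x y = d y x"
  by (meson antisym gdist_le relpowp_gdist relpowp_sym)

lemma gdist_adjacent_le: "E u v \<Longrightarrow> d x v \<le> Suc (d x u)"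
  by (meson gdist_le relpowp_Suc_I relpowp_gdist)

lemma adjacent_sym: "E u v \<longleftrightarrow> E v u"
  using symp_adj by (meson sympD)

lemma adjacent_iff_gdist: "E u v \<longleftrightarrow> d u v = 1"
proof
  assume "E u v"
  then have "d u v \<le> 1" "u \<noteq> v"
    using gdist_le[of 1 u v] irreflp_adj by (auto simp: irreflp_def)
  then show "d u v = 1" using gdist_eq_0_iff[of u v] by linarith
next
  assume "d u v = 1"
  then show "E u v" using relpowp_gdist[of u v] by auto
qed

lemma ex_adjacent_nearer:
  assumes "u \<noteq> x"
  shows "\<exists>w. E u w \<and> d x u = Suc (d x w)"
proof -
  have "d x u \<noteq> 0" using assms by auto
  then obtain n where n: "d x u = Suc n" by (meson not0_implies_Suc)
  then obtain w where "(E ^^ n) x w" "E w u" using relpowp_gdist[of x u] by auto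
  moreover from this have "d x w \<le> n" "Suc n \<le> Suc (d x w)"
    using gdist_le gdist_adjacent_le[of w u x] n by auto
  ultimately show ?thesis using n adjacent_sym by (metis Suc_le_mono antisym)
qed

text \<open>This is where acyclicity enters. If \<open>v\<close> and \<open>w\<close> were distinct, then descending
towards \<open>x\<close> from both of them would join them by a path that misses \<open>u\<close>, since the
distance to \<open>x\<close> only decreases on the way; together with \<open>u\<close> that path would be a
cycle. Allowing equal distances in the hypotheses excludes edges between vertices at the same
distance from \<open>x\<close> as well.\<close>

lemma adjacent_nearer_unique:
  assumes uv: "E u v" "d x v \<le> d x u" and uw: "E u w" "d x w \<le> d x u"
  shows "v = w"
proof (rule ccontr)
  assume "v \<noteq> w"
  \<comment> \<open>The edges of the graph with \<open>u\<close> removed.\<close>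
  define R where "R = (\<lambda>a b. E a b \<and> a \<noteq> u \<and> b \<noteq> u)"
  have sym_R: "symp R" using symp_adj by (auto simp: R_def symp_def)
  have reach: "R\<^sup>*\<^sup>* a x" if "a \<noteq> u" "d x a \<le> d x u" for a
    using that
  proof (induction "d x a" arbitrary: a rule: less_induct)
    case less
    show ?case
    proof (cases "a = x")
      case False
      then obtain b where b: "E a b" "d x a = Suc (d x b)" using ex_adjacent_nearer by blast
      then have "b \<noteq> u" using less.prems by auto
      then have "R a b" using b less.prems by (auto simp: R_def)
      moreover have "R\<^sup>*\<^sup>* b x" using less b \<open>b \<noteq> u\<close> by auto
      ultimately show ?thesis by (rule converse_rtranclp_into_rtranclp)
    qed simp
  qed
  have "v \<noteq> u" "w \<noteq> u" using uv uw irreflp_adj by (auto simp: irreflp_def)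
  then have "R\<^sup>*\<^sup>* v x" "R\<^sup>*\<^sup>* x w"
    using reach uv uw sym_R by (auto intro: sympD[OF symp_rtranclp])
  then have "R\<^sup>*\<^sup>* v w" by (rule rtranclp_trans)
  then obtain xs where xs: "walk R v xs w" "distinct xs" using rtranclp_distinct_path by metis
  then obtain a b ys where ys: "xs = a # b # ys"
    using \<open>v \<noteq> w\<close> by (cases xs rule: remdups_adj.cases) (auto simp: walk_def)
  have "successively E xs" using xs by (auto simp: walk_def R_def intro: successively_mono)
  moreover have "u \<notin> set xs"
  proof -
    have "successively R zs \<Longrightarrow> hd zs \<noteq> u \<Longrightarrow> u \<notin> set zs" for zs
      by (induction zs) (auto simp: successively_Cons R_def)
    then show ?thesis using xs \<open>v \<noteq> u\<close> by (metis walk_def)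
  qed
  ultimately have "distinct (u # xs) \<and> successively E (u # xs) \<and> E (last (u # xs)) u"
    using xs ys uv uw adjacent_sym[of w u] by (simp add: walk_def)
  then have "graph_cycle E (u # xs)" using ys by (simp add: graph_cycle_def)
  then show False using no_cycle by blast
qed

lemma gdist_adjacent_neq:
  assumes "E u v" shows "d x u \<noteq> d x v"
proof
  assume eq: "d x u = d x v"
  show False
  proof (cases "u = x")
    case True
    then have "x = v" using eq gdist_eq_0_iff by metis
    then show False using True assms irreflp_adj by (auto simp: irreflp_def)
  next
    case False
    then obtain w where "E u w" "d x u = Suc (d x w)" using ex_adjacent_nearer by blast
    then show False using adjacent_nearer_unique[of u v x w] assms eq by auto
  qed
qed

lemma gdist_adjacent_cases:
  assumes "E u v"
  shows "d x v = Suc (d x u) \<or> d x u = Suc (d x v)"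
  using gdist_adjacent_neq[OF assms, of x] gdist_adjacent_le[of u v x] gdist_adjacent_le[of v u x]
    assms adjacent_sym[of u v] by linarith

end

section \<open>Levels and ancestors\<close>

context weighted_tree
begin

sublocale tree_graph E
  using tree by unfold_locales (auto simp: homogeneous_tree_def)

lemma finite_neighbours: "finite {y. E x y}"
  using tree unfolding homogeneous_tree_def by (metis add_is_0 card.infinite one_neq_zero)

lemma inj_on_N: "inj_on N g"
proof (rule inj_onI)
  fix x y assume "x \<in> g" "y \<in> g" "N x = N y"
  then have "int (d x y) = 0" using N_dist[of x y] by simp
  then show "x = y" by simp
qed

text \<open>The two neighbours of \<open>x\<close> on the geodesic have values of \<open>N\<close> at distance 1 from
\<open>N x\<close>; these values differ because \<open>N\<close> is injective, so one is above and one below.\<close>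

lemma geodesic_neighbours:
  assumes "x \<in> g"
  shows "\<exists>y\<in>g. E x y \<and> N y = N x + 1" and "\<exists>y\<in>g. E x y \<and> N y = N x - 1"
proof -
  have "card {y\<in>g. E x y} = 2"
    using geodesic assms by (auto simp: doubly_infinite_geodesic_def)
  then obtain a b where ab: "{y\<in>g. E x y} = {a, b}" "a \<noteq> b" by (auto simp: card_2_iff)
  then have in_g: "a \<in> g" "b \<in> g" "E x a" "E x b" by auto
  then have "\<bar>N x - N a\<bar> = 1" "\<bar>N x - N b\<bar> = 1"
    using N_dist[OF assms] by (simp_all add: adjacent_iff_gdist)
  moreover have "N a \<noteq> N b" using inj_on_N ab in_g by (auto dest: inj_onD)
  ultimately have "N a = N x + 1 \<and> N b = N x - 1 \<or> N a = N x - 1 \<and> N b = N x + 1"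
    by linarith
  with in_g show "\<exists>y\<in>g. E x y \<and> N y = N x + 1" "\<exists>y\<in>g. E x y \<and> N y = N x - 1" by auto
qed

lemma ex_geodesic_point_above: "\<exists>t\<in>g. n \<le> N t"
proof -
  obtain x where x: "x \<in> g" using geodesic by (auto simp: doubly_infinite_geodesic_def)
  have "\<exists>t\<in>g. N t = N x + int k" for k
  proof (induction k)
    case (Suc k)
    then obtain t where t: "t \<in> g" "N t = N x + int k" by blast
    obtain y where "y \<in> g" "N y = N t + 1" using geodesic_neighbours(1)[OF t(1)] by blast
    then show ?case using t(2) by (intro bexI[of _ y]) auto
  qed (use x in auto)
  from this[of "nat (n - N x)"] obtain t where "t \<in> g" "N t = N x + int (nat (n - N x))"
    by blast
  then show ?thesis by (intro bexI[of _ t]) auto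
qed

definition nearest :: "'v \<Rightarrow> 'v \<Rightarrow> bool" where
  "nearest x x' \<longleftrightarrow> x' \<in> g \<and> (\<forall>y\<in>g. d x x' \<le> d x y)"

text \<open>The path from \<open>x\<close> to its nearest point \<open>x'\<close> on the geodesic, continued upwards along
the geodesic, is again shortest. The first step away from \<open>x'\<close> increases the distance to
\<open>x\<close> because \<open>x'\<close> is nearest. Afterwards, the only neighbour of a vertex that is nearer
to \<open>x\<close> is the one the path came from, so the distance continues to increase.\<close>

lemma gdist_above_nearest:
  assumes x': "nearest x x'" and "t \<in> g" "N t = N x' + int k"
  shows "d x t = d x x' + k"
  using assms(2,3)
proof (induction k arbitrary: t rule: less_induct)
  case (less k)
  consider "k = 0" | "k = 1" | j where "k = Suc (Suc j)"
    by (metis One_nat_def not0_implies_Suc)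
  then show ?case
  proof cases
    case 1
    then have "t = x'" using less.prems x' inj_on_N by (auto simp: nearest_def dest: inj_onD)
    then show ?thesis using 1 by simp
  next
    case 2
    have "d x' t = 1"
      using N_dist[of x' t] x' less.prems 2 by (auto simp: nearest_def)
    then have "E x' t" by (simp add: adjacent_iff_gdist)
    moreover have "d x x' \<le> d x t" using x' less.prems by (auto simp: nearest_def)
    ultimately show ?thesis using gdist_adjacent_cases[of x' t x] 2 by auto
  next
    case 3
    obtain s where s: "s \<in> g" "E t s" "N s = N t - 1"
      using geodesic_neighbours(2) less.prems by blast
    obtain r where r: "r \<in> g" "E s r" "N r = N s - 1"
      using geodesic_neighbours(2) s by blast
    have "d x s = d x x' + Suc j" "d x r = d x x' + j"
      using less.IH[of "Suc j" s] less.IH[of j r] s r 3 less.prems by auto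
    moreover have "r \<noteq> t" using r s by auto
    ultimately have "\<not> d x t \<le> d x s"
      using adjacent_nearer_unique[of s r x t] r s adjacent_sym[of s t] by auto
    then show ?thesis
      using gdist_adjacent_cases[of s t x] s adjacent_sym[of s t] 3 \<open>d x s = _\<close> by auto
  qed
qed

text \<open>Two nearest points can be compared through a geodesic point \<open>t\<close> above both: the distance
from \<open>x\<close> to \<open>t\<close> determines the height of either of them. This makes the definite description
in the definition of \<open>proj\<close> meaningful.\<close>

lemma nearest_proj: "nearest x (proj x)"
proof -
  obtain z where "z \<in> g" using geodesic by (auto simp: doubly_infinite_geodesic_def)
  then obtain x' where x': "nearest x x'"
    using ex_has_least_nat[of "\<lambda>y. y \<in> g" z "d x"] by (auto simp: nearest_def)
  have "y = x'" if y: "nearest x y" for y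
  proof -
    obtain t where t: "t \<in> g" "max (N y) (N x') \<le> N t" using ex_geodesic_point_above by blast
    have "d x y = d x x'" using x' y by (auto simp: nearest_def intro: antisym)
    moreover have "d x t = d x x' + nat (N t - N x')" "d x t = d x y + nat (N t - N y)"
      using t by (auto intro!: gdist_above_nearest x' y)
    ultimately have "N y = N x'" using t by linarith
    then show "y = x'" using x' y inj_on_N by (auto simp: nearest_def dest: inj_onD)
  qed
  with x' have "\<exists>!y. nearest x y" by blast
  then show ?thesis unfolding proj_def nearest_def[symmetric] by (rule theI')
qed

text \<open>The level is, up to sign, the Busemann function of the upper end of the geodesic. In this form the
projection disappears, and level differences become differences of distances to one point.\<close>

lemma level_eq_Busemann:
  assumes "t \<in> g" "N (proj x) \<le> N t"
  shows "level x = N t - int (d x t)"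
proof -
  have "d x t = d x (proj x) + nat (N t - N (proj x))"
    using assms by (intro gdist_above_nearest nearest_proj) auto
  then show ?thesis using assms by (simp add: level_def)
qed

lemma ex_common_far_point:
  assumes "finite A"
  shows "\<exists>t\<in>g. \<forall>x\<in>A. x \<noteq> t \<and> level x = N t - int (d x t)"
proof -
  obtain t where t: "t \<in> g" "Max (insert 0 ((\<lambda>x. N (proj x)) ` A)) + 1 \<le> N t"
    using ex_geodesic_point_above by blast
  have "x \<noteq> t \<and> level x = N t - int (d x t)" if "x \<in> A" for x
  proof -
    have "N (proj x) \<le> Max (insert 0 ((\<lambda>x. N (proj x)) ` A))"
      using assms that by (intro Max_ge) auto
    then have less: "N (proj x) < N t" using t by linarith
    have "x \<noteq> t"
    proof
      assume "x = t"
      have "d t (proj t) \<le> d t t" using nearest_proj[of t] t(1) unfolding nearest_def by blast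
      moreover have "d t t = 0" by simp
      ultimately have "d t (proj t) = 0" by simp
      then have "proj t = t" by (simp only: gdist_eq_0_iff)
      then show False using less \<open>x = t\<close> by simp
    qed
    then show ?thesis using level_eq_Busemann[OF t(1), of x] less by simp
  qed
  with t show ?thesis by blast
qed

lemma level_adjacent_cases:
  assumes "E x y"
  shows "level y = level x + 1 \<or> level y = level x - 1"
proof -
  obtain t where "t \<in> g" "\<forall>u\<in>{x, y}. u \<noteq> t \<and> level u = N t - int (d u t)"
    using ex_common_far_point[of "{x, y}"] by blast
  then show ?thesis using gdist_adjacent_cases[OF assms, of t] by (auto simp: gdist_commute)
qed

text \<open>Seen from a point \<open>t\<close> of the geodesic that is high enough for \<open>x\<close> and all its
neighbours, the neighbours of higher level are those nearer to \<open>t\<close>, and there is exactly one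
of these. So the tree is a genealogy in which every vertex has one parent.\<close>

lemma ex1_upper_neighbour: "\<exists>!y. E x y \<and> level y = level x + 1"
proof -
  obtain t where t: "t \<in> g" "\<forall>u\<in>insert x {y. E x y}. u \<noteq> t \<and> level u = N t - int (d u t)"
    using ex_common_far_point[of "insert x {y. E x y}"] finite_neighbours by blast
  have up: "level y = level x + 1 \<longleftrightarrow> d t y < d t x" if "E x y" for y
    using t that gdist_adjacent_cases[OF that, of t] by (auto simp: gdist_commute)
  obtain y where "E x y" "d t x = Suc (d t y)" using ex_adjacent_nearer[of x t] t by auto
  then show ?thesis using up adjacent_nearer_unique[of x _ t] by (metis lessI less_imp_le)
qed

definition parent :: "'v \<Rightarrow> 'v" where
  "parent x = (THE y. E x y \<and> level y = level x + 1)"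

lemma adjacent_parent: "E x (parent x)" and level_parent: "level (parent x) = level x + 1"
  using theI'[OF ex1_upper_neighbour[of x]] by (auto simp: parent_def)

lemma parent_eqI: "E x y \<Longrightarrow> level y = level x + 1 \<Longrightarrow> parent x = y"
  unfolding parent_def by (rule the1_equality[OF ex1_upper_neighbour]) simp

lemma adjacent_iff_parent: "E x y \<longleftrightarrow> y = parent x \<or> x = parent y"
  using level_adjacent_cases[of x y] parent_eqI[of x y] parent_eqI[of y x]
    adjacent_parent[of x] adjacent_parent[of y] adjacent_sym[of x y] by auto

abbreviation ancestor :: "nat \<Rightarrow> 'v \<Rightarrow> 'v" where "ancestor n \<equiv> parent ^^ n"

lemma level_ancestor: "level (ancestor n x) = level x + int n"
  by (induction n) (auto simp: level_parent)

lemma level_relpowp: "(E ^^ n) x y \<Longrightarrow> level y \<le> level x + int n"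
proof (induction n arbitrary: y)
  case (Suc n)
  then obtain z where z: "(E ^^ n) x z" "E z y" by auto
  show ?case using Suc.IH[OF z(1)] level_adjacent_cases[OF z(2)] by auto
qed simp

lemma level_le_gdist: "level y \<le> level x + int (d x y)"
  using level_relpowp relpowp_gdist .

text \<open>A walk of length \<open>n\<close> that gains \<open>n\<close> levels gains one level in each step, hence always
moves to the parent.\<close>

lemma relpowp_ascending_imp_ancestor:
  "(E ^^ n) x y \<Longrightarrow> level y = level x + int n \<Longrightarrow> ancestor n x = y"
proof (induction n arbitrary: y)
  case (Suc n)
  then obtain z where z: "(E ^^ n) x z" "E z y" by auto
  have "level z = level x + int n" "level y = level z + 1"
    using level_relpowp[OF z(1)] level_adjacent_cases[OF z(2)] Suc.prems by auto
  then show ?case using Suc.IH z parent_eqI by auto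
qed simp

lemma gdist_ancestor: "d x (ancestor n x) = n"
proof (rule antisym)
  have "(E ^^ n) x (ancestor n x)"
    by (induction n) (auto intro: relpowp_Suc_I adjacent_parent)
  then show "d x (ancestor n x) \<le> n" by (rule gdist_le)
  show "n \<le> d x (ancestor n x)"
    using level_le_gdist[of "ancestor n x" x] by (simp add: level_ancestor)
qed

lemma below_iff_ancestor: "below x z \<longleftrightarrow> (\<exists>n. ancestor n x = z)"
proof
  assume "below x z"
  then have "level z = level x + int (d x z)" by (simp add: below_def)
  then show "\<exists>n. ancestor n x = z" using relpowp_ascending_imp_ancestor relpowp_gdist by blast
qed (auto simp: below_def level_ancestor gdist_ancestor)

text \<open>The vertices below \<open>z\<close> at depth \<open>n\<close>. Envelopes of trapezoids are unions of consecutive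
slices, and all slices of \<open>z\<close> have the same mass.\<close>

definition slice :: "nat \<Rightarrow> 'v \<Rightarrow> 'v set" where
  "slice n z = {x. ancestor n x = z}"

lemma level_slice: "x \<in> slice n z \<Longrightarrow> level x = level z - int n"
  using level_ancestor[of n x] by (auto simp: slice_def)

lemma below_iff_slice: "below x z \<and> level z - level x = int n \<longleftrightarrow> x \<in> slice n z"
  by (auto simp: below_iff_ancestor slice_def level_ancestor)

lemma card_slice: "finite (slice n z) \<and> card (slice n z) = q ^ n"
proof (induction n arbitrary: z)
  case (Suc n)
  define C where "C = {y. parent y = z}"
  have "{y. E z y} = insert (parent z) C" by (auto simp: adjacent_iff_parent C_def)
  moreover have "parent z \<notin> C"
    using level_parent[of z] level_parent[of "parent z"] by (auto simp: C_def)
  moreover have "finite C" using finite_neighbours[of z] calculation by simp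
  moreover have "card {y. E z y} = q + 1" using tree by (auto simp: homogeneous_tree_def)
  ultimately have C: "finite C" "card C = q" by auto
  have "slice (Suc n) z = (\<Union>y\<in>C. slice n y)" by (auto simp: slice_def C_def)
  moreover have "card (\<Union>y\<in>C. slice n y) = (\<Sum>y\<in>C. card (slice n y))"
    using C Suc.IH by (intro card_UN_disjoint) (auto simp: slice_def)
  ultimately show ?case using C Suc.IH by auto
qed (auto simp: slice_def)

lemma countable_vertices: "countable (UNIV :: 'v set)"
proof -
  fix o' :: 'v
  have "finite {y. (E ^^ n) o' y}" for n
  proof (induction n)
    case (Suc n)
    have "{y. (E ^^ Suc n) o' y} = (\<Union>z\<in>{z. (E ^^ n) o' z}. {y. E z y})" by auto
    then show ?case using Suc finite_neighbours by auto
  qed simp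
  moreover have "(UNIV :: 'v set) = (\<Union>n. {y. (E ^^ n) o' y})" using relpowp_gdist by blast
  ultimately show ?thesis by (metis countable_UN countable_finite countableI_type)
qed

end

section \<open>Measures on countable sets with positive point masses\<close>

text \<open>Countability gives an exhaustion by finite sets, outside of which a given integrable or
square integrable function becomes negligible. Positivity of the masses makes evaluation at a point
continuous.\<close>

locale weighted_points =
  fixes w :: "'v \<Rightarrow> real"
  assumes w_pos: "0 < w x" and countable_points: "countable (UNIV :: 'v set)"
begin

definition \<nu> :: "'v measure" where
  "\<nu> = density (count_space UNIV) (\<lambda>x. ennreal (w x))"

lemma w_nonneg [simp]: "0 \<le> w x"
  using w_pos[of x] by simp

lemma w_neq_0 [simp]: "w x \<noteq> 0"
  using w_pos[of x] by simp

lemma sets_\<nu> [simp]: "sets \<nu> = UNIV" and space_\<nu> [simp]: "space \<nu> = UNIV"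
  by (auto simp: \<nu>_def)

lemma measurable_\<nu> [measurable, simp]: "f \<in> measurable \<nu> N" if "f \<in> UNIV \<rightarrow> space N"
  using that by (auto simp: measurable_def)

lemma borel_measurable_\<nu> [simp]: "f \<in> borel_measurable \<nu>"
  by simp

lemma AE_\<nu>_iff: "(AE x in \<nu>. P x) \<longleftrightarrow> (\<forall>x. P x)"
  unfolding \<nu>_def using w_pos by (subst AE_density) (auto simp: AE_count_space)

lemma nn_integral_\<nu>: "(\<integral>\<^sup>+x. f x \<partial>\<nu>) = (\<integral>\<^sup>+x. ennreal (w x) * f x \<partial>count_space UNIV)"
  unfolding \<nu>_def by (subst nn_integral_density) auto

lemma nn_integral_\<nu>_finite:
  assumes "finite F" "\<And>x. x \<notin> F \<Longrightarrow> f x = 0"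
  shows "(\<integral>\<^sup>+x. f x \<partial>\<nu>) = (\<Sum>x\<in>F. ennreal (w x) * f x)"
  unfolding nn_integral_\<nu> using assms by (intro nn_integral_count_space'[OF assms(1)]) auto

lemma point_le_nn_integral: "ennreal (w x) * f x \<le> (\<integral>\<^sup>+x. f x \<partial>\<nu>)"
  unfolding nn_integral_\<nu> by (rule nn_integral_ge_point) simp

lemma integrable_\<nu>_finite:
  fixes f :: "'v \<Rightarrow> 'b::{banach, second_countable_topology}"
  assumes "finite F" "\<And>x. x \<notin> F \<Longrightarrow> f x = 0"
  shows "integrable \<nu> f"
proof (rule integrableI_bounded)
  have "(\<integral>\<^sup>+x. ennreal (norm (f x)) \<partial>\<nu>) = (\<Sum>x\<in>F. ennreal (w x) * ennreal (norm (f x)))"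
    using assms by (intro nn_integral_\<nu>_finite) auto
  then show "(\<integral>\<^sup>+x. ennreal (norm (f x)) \<partial>\<nu>) < \<infinity>"
    by (simp add: ennreal_mult[symmetric] del: ennreal_mult)
qed simp

lemma integral_\<nu>_finite:
  fixes f :: "'v \<Rightarrow> 'b::{banach, second_countable_topology}"
  assumes "finite F" "\<And>x. x \<notin> F \<Longrightarrow> f x = 0"
  shows "(\<integral>x. f x \<partial>\<nu>) = (\<Sum>x\<in>F. w x *\<^sub>R f x)"
proof -
  have fin: "{x \<in> UNIV. w x *\<^sub>R f x \<noteq> 0} \<subseteq> F" using assms by auto
  have "(\<integral>x. f x \<partial>\<nu>) = (\<integral>x. w x *\<^sub>R f x \<partial>count_space UNIV)"
    unfolding \<nu>_def by (rule integral_density) auto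
  also have "\<dots> = (\<Sum>x | x \<in> UNIV \<and> w x *\<^sub>R f x \<noteq> 0. w x *\<^sub>R f x)"
    using finite_subset[OF fin assms(1)] by (rule lebesgue_integral_count_space_finite_support)
  also have "\<dots> = (\<Sum>x\<in>F. w x *\<^sub>R f x)"
    using fin assms(1) by (intro sum.mono_neutral_left) auto
  finally show ?thesis .
qed

lemma measure_\<nu>_finite: "finite F \<Longrightarrow> measure \<nu> F = sum w F"
  using integral_\<nu>_finite[of F "indicator F :: 'v \<Rightarrow> real"] by simp

lemma finite_exhaustion:
  obtains F :: "nat \<Rightarrow> 'v set" where "\<And>n. finite (F n)" "\<And>x. \<forall>\<^sub>F n in sequentially. x \<in> F n"
proof
  fix n and x :: 'v
  have inj: "inj (to_nat_on (UNIV :: 'v set))" using countable_points by (rule inj_on_to_nat_on)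
  have "{y. to_nat_on (UNIV :: 'v set) y < n} = to_nat_on (UNIV :: 'v set) -` {..<n}" by auto
  then show "finite {y. to_nat_on (UNIV :: 'v set) y < n}"
    using inj by (simp add: finite_vimageI)
  show "\<forall>\<^sub>F n in sequentially. x \<in> {y. to_nat_on (UNIV :: 'v set) y < n}"
    by (simp add: eventually_gt_at_top)
qed

lemma L2_space_iff: "f \<in> L2_space \<nu> \<longleftrightarrow> integrable \<nu> (\<lambda>x. (cmod (f x))\<^sup>2)"
  by (simp add: L2_space_def)

lemma L2_norm_nonneg: "0 \<le> L2_norm \<nu> f"
  by (simp add: L2_norm_def)

lemma L2_norm_finite:
  assumes "finite F" "\<And>x. x \<notin> F \<Longrightarrow> f x = 0"
  shows "(L2_norm \<nu> f)\<^sup>2 = (\<Sum>x\<in>F. w x * (cmod (f x))\<^sup>2)"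
  using integral_\<nu>_finite[of F "\<lambda>x. (cmod (f x))\<^sup>2"] assms by (simp add: L2_norm_def sum_nonneg)

lemma finite_support_L2: "finite F \<Longrightarrow> (\<And>x. x \<notin> F \<Longrightarrow> f x = 0) \<Longrightarrow> f \<in> L2_space \<nu>"
  unfolding L2_space_iff by (rule integrable_\<nu>_finite) auto

lemma restrict_L2: "f \<in> L2_space \<nu> \<Longrightarrow> (\<lambda>x. f x * indicator A x) \<in> L2_space \<nu>"
  unfolding L2_space_iff by (rule Bochner_Integration.integrable_bound) (auto split: split_indicator)

lemma sum_le_L2_norm:
  assumes "f \<in> L2_space \<nu>" "finite F"
  shows "(\<Sum>x\<in>F. w x * (cmod (f x))\<^sup>2) \<le> (L2_norm \<nu> f)\<^sup>2"
proof -
  have "(\<Sum>x\<in>F. w x * (cmod (f x))\<^sup>2) = (\<integral>x. (cmod (f x * indicator F x))\<^sup>2 \<partial>\<nu>)"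
    using integral_\<nu>_finite[of F "\<lambda>x. (cmod (f x * indicator F x))\<^sup>2"] assms by simp
  also have "\<dots> \<le> (\<integral>x. (cmod (f x))\<^sup>2 \<partial>\<nu>)"
    using restrict_L2[OF assms(1), of F] assms
    by (intro integral_mono) (auto simp: L2_space_iff split: split_indicator)
  finally show ?thesis by (simp add: L2_norm_def)
qed

end

section \<open>Matrices of operators bounded on square integrable functions\<close>

locale L2_bounded_operator = weighted_points w for w :: "'v \<Rightarrow> real" +
  fixes T :: "('v \<Rightarrow> complex) \<Rightarrow> ('v \<Rightarrow> complex)" and B :: real
  assumes T_L2: "f \<in> L2_space \<nu> \<Longrightarrow> T f \<in> L2_space \<nu>"
    and T_add: "f \<in> L2_space \<nu> \<Longrightarrow> f' \<in> L2_space \<nu> \<Longrightarrow> T (\<lambda>x. f x + f' x) = (\<lambda>x. T f x + T f' x)"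
    and T_scale: "f \<in> L2_space \<nu> \<Longrightarrow> T (\<lambda>x. c * f x) = (\<lambda>x. c * T f x)"
    and T_bound: "f \<in> L2_space \<nu> \<Longrightarrow> L2_norm \<nu> (T f) \<le> B * L2_norm \<nu> f"
    and B_nonneg: "0 \<le> B"
begin

text \<open>The matrix of \<open>T\<close> relative to \<open>\<nu>\<close>, diagonal included.\<close>

definition kernel :: "'v \<Rightarrow> 'v \<Rightarrow> complex" where
  "kernel x y = T (indicator {y}) x / of_real (w y)"

lemma T_pointwise_bound:
  assumes "f \<in> L2_space \<nu>"
  shows "w x * (cmod (T f x))\<^sup>2 \<le> (B * L2_norm \<nu> f)\<^sup>2"
proof -
  have "w x * (cmod (T f x))\<^sup>2 \<le> (L2_norm \<nu> (T f))\<^sup>2"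
    using sum_le_L2_norm[OF T_L2[OF assms], of "{x}"] by simp
  also have "\<dots> \<le> (B * L2_norm \<nu> f)\<^sup>2"
    using T_bound[OF assms] L2_norm_nonneg by (intro power_mono)
  finally show ?thesis .
qed

lemma T_finite_support:
  assumes "finite F" "\<And>x. x \<notin> F \<Longrightarrow> f x = 0"
  shows "T f x = (\<Sum>y\<in>F. w y *\<^sub>R (kernel x y * f y))"
  using assms
proof (induction F arbitrary: f)
  case empty
  then have "f = (\<lambda>y. 0 * f y)" "f \<in> L2_space \<nu>"
    using finite_support_L2[of "{}" f] by auto
  then show ?case using T_scale[of f 0] by (metis mult_zero_left sum.empty)
next
  case (insert z F)
  define h where "h = (\<lambda>y. f y * indicator F y)"
  have h: "h y = 0" if "y \<notin> F" for y using that by (simp add: h_def)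
  have ind: "indicator {z} \<in> L2_space \<nu>" by (rule finite_support_L2[of "{z}"]) auto
  have hL: "h \<in> L2_space \<nu>" by (rule finite_support_L2[OF insert.hyps(1)]) (rule h)
  have zL: "(\<lambda>y. f z * indicator {z} y) \<in> L2_space \<nu>" by (rule finite_support_L2[of "{z}"]) auto
  have "f = (\<lambda>y. f z * indicator {z} y + h y)"
    using insert by (auto simp: h_def fun_eq_iff split: split_indicator)
  then have "T f x = f z * T (indicator {z}) x + T h x"
    using T_add[OF zL hL] T_scale[OF ind, of "f z"] by metis
  also have "T h x = (\<Sum>y\<in>F. w y *\<^sub>R (kernel x y * h y))" using h by (rule insert.IH)
  also have "\<dots> = (\<Sum>y\<in>F. w y *\<^sub>R (kernel x y * f y))"
    by (intro sum.cong) (auto simp: h_def)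
  also have "f z * T (indicator {z}) x = w z *\<^sub>R (kernel x z * f z)"
    by (simp add: kernel_def scaleR_conv_of_real)
  finally show ?case using insert.hyps by simp
qed

text \<open>Evaluation of \<open>T f\<close> at \<open>x\<close> is a bounded functional on \<open>L\<^sup>2\<close>, because \<open>x\<close>
has positive mass. Row \<open>x\<close> of the matrix represents this functional, so its \<open>L\<^sup>2\<close> norm
is the norm of the functional; on a finite set this is seen by testing on the conjugate of the row.\<close>

lemma kernel_row_L2:
  assumes "finite F"
  shows "(\<Sum>y\<in>F. w y * (cmod (kernel x y))\<^sup>2) \<le> B\<^sup>2 / w x"
proof -
  define S where "S = (\<Sum>y\<in>F. w y * (cmod (kernel x y))\<^sup>2)"
  define f where "f = (\<lambda>y. cnj (kernel x y) * indicator F y)"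
  have f: "f y = 0" if "y \<notin> F" for y using that by (simp add: f_def)
  have "T f x = (\<Sum>y\<in>F. w y *\<^sub>R (kernel x y * f y))"
    using T_finite_support[OF assms f] .
  also have "\<dots> = of_real S"
    unfolding S_def of_real_sum
    by (intro sum.cong) (auto simp: f_def scaleR_conv_of_real complex_norm_square[symmetric] simp flip: of_real_power)
  finally have "T f x = of_real S" .
  moreover have S_nonneg: "0 \<le> S" by (simp add: S_def sum_nonneg)
  ultimately have "cmod (T f x) = S" by simp
  moreover have "(L2_norm \<nu> f)\<^sup>2 = S"
    using L2_norm_finite[OF assms f] by (simp add: S_def f_def)
  moreover have "f \<in> L2_space \<nu>" using finite_support_L2[OF assms f] .
  ultimately have "w x * S\<^sup>2 \<le> B\<^sup>2 * S"
    using T_pointwise_bound[of f x] by (simp add: power_mult_distrib)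
  then have "S * (w x * S) \<le> S * B\<^sup>2" by (simp add: power2_eq_square mult_ac)
  then have "w x * S \<le> B\<^sup>2"
    using S_nonneg by (cases "S = 0") auto
  then show ?thesis using w_pos[of x] by (simp add: S_def pos_le_divide_eq mult.commute)
qed

lemma kernel_eq_off_diagonal:
  assumes "admits_kernel_off_diagonal \<nu> T K" "x \<noteq> y"
  shows "kernel x y = K x y"
proof -
  have "T (indicator {y}) x = (\<integral>z. K x z * indicator {y} z \<partial>\<nu>)"
    using assms by (auto simp: admits_kernel_off_diagonal_def indicator_eq_0_iff)
  also have "\<dots> = w y *\<^sub>R K x y"
    by (subst integral_\<nu>_finite[of "{y}"]) auto
  finally show ?thesis by (simp add: kernel_def scaleR_conv_of_real)
qed

text \<open>Near the support of the atom, on \<open>A'\<close>, the \<open>L\<^sup>2\<close> bound and the Cauchy-Schwarz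
inequality give \<open>B * sqrt D\<close>. Away from it, the mean value zero allows \<open>K x y\<close> to be
replaced by \<open>K x y - K x z\<close> for a fixed \<open>z\<close> in \<open>A\<close>, and the integral condition
gives \<open>H\<close>.\<close>

lemma atom_image_bound:
  assumes K: "admits_kernel_off_diagonal \<nu> T K"
    and A: "finite A'" "A \<subseteq> A'" "A \<noteq> {}" and D: "measure \<nu> A' \<le> D * measure \<nu> A"
    and a_support: "\<And>x. x \<notin> A \<Longrightarrow> a x = 0"
    and a_size: "\<And>x. cmod (a x) \<le> 1 / measure \<nu> A"
    and a_mean: "(\<integral>x. a x \<partial>\<nu>) = 0"
    and H: "0 \<le> H" "\<And>y z. y \<in> A \<Longrightarrow> z \<in> A \<Longrightarrow>
      (\<integral>\<^sup>+x\<in>- A'. ennreal (cmod (K x y - K x z)) \<partial>\<nu>) \<le> ennreal H"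
  shows "(\<integral>\<^sup>+x. ennreal (cmod (T a x)) \<partial>\<nu>) \<le> ennreal (B * sqrt D + H)"
proof -
  define m where "m = measure \<nu> A"
  have finA: "finite A" using A finite_subset by blast
  have m_eq: "m = sum w A" unfolding m_def using finA by (rule measure_\<nu>_finite)
  have m_pos: "0 < m" unfolding m_eq using finA A w_pos by (intro sum_pos) auto
  have aL2: "a \<in> L2_space \<nu>" using finA a_support by (rule finite_support_L2)
  have a_norm: "(L2_norm \<nu> a)\<^sup>2 \<le> 1 / m"
  proof -
    have "(L2_norm \<nu> a)\<^sup>2 = (\<Sum>x\<in>A. w x * (cmod (a x))\<^sup>2)"
      using finA a_support by (rule L2_norm_finite)
    also have "\<dots> \<le> (\<Sum>x\<in>A. w x * (1 / m)\<^sup>2)"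
      using a_size by (intro sum_mono mult_left_mono power_mono) (auto simp: m_def)
    also have "\<dots> = 1 / m"
      unfolding sum_distrib_right[symmetric] m_eq[symmetric]
      using m_pos by (simp add: power2_eq_square)
    finally show ?thesis .
  qed
  have local: "(\<integral>\<^sup>+x\<in>A'. ennreal (cmod (T a x)) \<partial>\<nu>) \<le> ennreal (B * sqrt D)"
  proof -
    have "(\<Sum>x\<in>A'. w x * cmod (T a x))\<^sup>2 = (\<Sum>x\<in>A'. sqrt (w x) * (sqrt (w x) * cmod (T a x)))\<^sup>2"
      by (simp add: mult.assoc[symmetric])
    also have "\<dots> \<le> (\<Sum>x\<in>A'. (sqrt (w x))\<^sup>2) * (\<Sum>x\<in>A'. (sqrt (w x) * cmod (T a x))\<^sup>2)"
      by (rule Cauchy_Schwarz_ineq_sum)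
    also have "\<dots> = measure \<nu> A' * (\<Sum>x\<in>A'. w x * (cmod (T a x))\<^sup>2)"
      using A by (simp add: measure_\<nu>_finite power_mult_distrib)
    also have "\<dots> \<le> (D * m) * (L2_norm \<nu> (T a))\<^sup>2"
      using D sum_le_L2_norm[OF T_L2[OF aL2] A(1)]
      by (intro mult_mono) (auto simp: m_def sum_nonneg intro: order_trans[OF measure_nonneg])
    also have "\<dots> \<le> (D * m) * (B\<^sup>2 * (1 / m))"
    proof (intro mult_left_mono)
      have "(L2_norm \<nu> (T a))\<^sup>2 \<le> (B * L2_norm \<nu> a)\<^sup>2"
        using T_bound[OF aL2] L2_norm_nonneg by (intro power_mono)
      also have "\<dots> \<le> B\<^sup>2 * (1 / m)"
        unfolding power_mult_distrib using a_norm by (intro mult_left_mono) auto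
      finally show "(L2_norm \<nu> (T a))\<^sup>2 \<le> B\<^sup>2 * (1 / m)" .
      show "0 \<le> D * m" using D by (auto simp: m_def intro: order_trans[OF measure_nonneg])
    qed
    also have "\<dots> = D * B\<^sup>2" using m_pos by simp
    finally have "(\<Sum>x\<in>A'. w x * cmod (T a x)) \<le> sqrt (D * B\<^sup>2)" by (rule real_le_rsqrt)
    also have "\<dots> = B * sqrt D" using B_nonneg by (simp add: real_sqrt_mult)
    finally have le: "(\<Sum>x\<in>A'. w x * cmod (T a x)) \<le> B * sqrt D" .
    have "(\<integral>\<^sup>+x\<in>A'. ennreal (cmod (T a x)) \<partial>\<nu>)
        = (\<Sum>x\<in>A'. ennreal (w x) * (ennreal (cmod (T a x)) * indicator A' x))"
      using A by (intro nn_integral_\<nu>_finite) auto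
    also have "\<dots> = ennreal (\<Sum>x\<in>A'. w x * cmod (T a x))"
      by (simp add: ennreal_mult[symmetric] del: ennreal_mult)
    finally show ?thesis using le by (simp add: ennreal_leI)
  qed
  obtain z where z: "z \<in> A" using A by blast
  have a_sum: "(\<Sum>y\<in>A. w y *\<^sub>R a y) = 0"
    using a_mean integral_\<nu>_finite[OF finA a_support] by simp
  have diff: "cmod (T a x) \<le> (\<Sum>y\<in>A. w y / m * cmod (K x y - K x z))" if "x \<notin> A'" for x
  proof -
    have "T a x = (\<Sum>y\<in>A. w y *\<^sub>R (kernel x y * a y))"
      using finA a_support by (rule T_finite_support)
    also have "\<dots> = (\<Sum>y\<in>A. w y *\<^sub>R (K x y * a y))"
    proof (intro sum.cong refl)
      fix y assume "y \<in> A"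
      then have "x \<noteq> y" using that A by blast
      then show "w y *\<^sub>R (kernel x y * a y) = w y *\<^sub>R (K x y * a y)"
        using kernel_eq_off_diagonal[OF K] by simp
    qed
    also have "\<dots> = (\<Sum>y\<in>A. w y *\<^sub>R (K x y * a y)) - K x z * (\<Sum>y\<in>A. w y *\<^sub>R a y)"
      by (simp add: a_sum)
    also have "\<dots> = (\<Sum>y\<in>A. w y *\<^sub>R ((K x y - K x z) * a y))"
      by (simp add: sum_distrib_left sum_subtractf algebra_simps)
    also have "cmod \<dots> \<le> (\<Sum>y\<in>A. cmod (w y *\<^sub>R ((K x y - K x z) * a y)))"
      by (rule norm_sum)
    also have "\<dots> \<le> (\<Sum>y\<in>A. w y / m * cmod (K x y - K x z))"
    proof (intro sum_mono)
      fix y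
      have "w y * cmod (K x y - K x z) * cmod (a y) \<le> w y * cmod (K x y - K x z) * (1 / m)"
        using a_size by (intro mult_left_mono) (auto simp: m_def)
      then show "cmod (w y *\<^sub>R ((K x y - K x z) * a y)) \<le> w y / m * cmod (K x y - K x z)"
        by (simp add: norm_mult mult_ac)
    qed
    finally show ?thesis .
  qed
  have far: "(\<integral>\<^sup>+x\<in>- A'. ennreal (cmod (T a x)) \<partial>\<nu>) \<le> ennreal H"
  proof -
    have "(\<integral>\<^sup>+x\<in>- A'. ennreal (cmod (T a x)) \<partial>\<nu>)
        \<le> (\<integral>\<^sup>+x. (\<Sum>y\<in>A. ennreal (w y / m) * (ennreal (cmod (K x y - K x z)) * indicator (- A') x)) \<partial>\<nu>)"
    proof (rule nn_integral_mono)
      fix x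
      have "ennreal (cmod (T a x)) \<le> (\<Sum>y\<in>A. ennreal (w y / m) * ennreal (cmod (K x y - K x z)))"
        if "x \<notin> A'"
        using diff[OF that] m_pos
        by (simp add: ennreal_mult[symmetric] ennreal_leI del: ennreal_mult)
      then show "ennreal (cmod (T a x)) * indicator (- A') x
          \<le> (\<Sum>y\<in>A. ennreal (w y / m) * (ennreal (cmod (K x y - K x z)) * indicator (- A') x))"
        by (cases "x \<in> A'") auto
    qed
    also have "\<dots> = (\<Sum>y\<in>A. ennreal (w y / m) * (\<integral>\<^sup>+x\<in>- A'. ennreal (cmod (K x y - K x z)) \<partial>\<nu>))"
      by (simp add: nn_integral_sum nn_integral_cmult)
    also have "\<dots> \<le> (\<Sum>y\<in>A. ennreal (w y / m) * ennreal H)"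
      using H z by (intro sum_mono mult_left_mono) auto
    also have "\<dots> = ennreal (\<Sum>y\<in>A. w y / m * H)"
      using H m_pos by (simp add: ennreal_mult[symmetric] del: ennreal_mult)
    also have "(\<Sum>y\<in>A. w y / m * H) = H"
      using m_pos by (simp add: sum_distrib_right[symmetric] sum_divide_distrib[symmetric] m_eq[symmetric])
    finally show ?thesis .
  qed
  have "(\<integral>\<^sup>+x. ennreal (cmod (T a x)) \<partial>\<nu>)
      = (\<integral>\<^sup>+x. ennreal (cmod (T a x)) * indicator A' x + ennreal (cmod (T a x)) * indicator (- A') x \<partial>\<nu>)"
    by (intro nn_integral_cong) (auto split: split_indicator)
  also have "\<dots> = (\<integral>\<^sup>+x\<in>A'. ennreal (cmod (T a x)) \<partial>\<nu>) + (\<integral>\<^sup>+x\<in>- A'. ennreal (cmod (T a x)) \<partial>\<nu>)"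
    by (rule nn_integral_add) auto
  also have "\<dots> \<le> ennreal (B * sqrt D) + ennreal H" using local far by (rule add_mono)
  also have "\<dots> = ennreal (B * sqrt D + H)"
  proof -
    have "0 \<le> D * m" using D by (auto simp: m_def intro: order_trans[OF measure_nonneg])
    then have "0 \<le> D" using m_pos by (simp add: zero_le_mult_iff)
    then show ?thesis using H B_nonneg by simp
  qed
  finally show ?thesis .
qed

end

section \<open>Extension to integrable functions\<close>

text \<open>When the rows of the matrix are bounded, the matrix acts on all of \<open>L\<^sup>1\<close>. The bound may
depend on the row, because its purpose is to pass to limits at one point at a time; it does not
enter the norm of the extension.\<close>

locale L2_operator_bounded_kernel = L2_bounded_operator w T B
  for w :: "'v \<Rightarrow> real" and T B +
  fixes S :: "'v \<Rightarrow> real"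
  assumes kernel_bounded: "cmod (kernel x y) \<le> S x"
begin

definition T_ext :: "('v \<Rightarrow> complex) \<Rightarrow> ('v \<Rightarrow> complex)" where
  "T_ext f x = (\<integral>y. kernel x y * f y \<partial>\<nu>)"

lemma integrable_kernel_mult:
  assumes "integrable \<nu> f"
  shows "integrable \<nu> (\<lambda>y. kernel x y * f y)"
proof (rule Bochner_Integration.integrable_bound)
  show "integrable \<nu> (\<lambda>y. S x * cmod (f y))" using assms by simp
  have "0 \<le> S x" using kernel_bounded[of x x] norm_ge_zero order_trans by blast
  then show "AE y in \<nu>. cmod (kernel x y * f y) \<le> norm (S x * cmod (f y))"
    using kernel_bounded by (simp add: norm_mult mult_right_mono)
qed simp

lemma T_ext_add:
  assumes "integrable \<nu> f" "integrable \<nu> h"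
  shows "T_ext (\<lambda>x. f x + h x) = (\<lambda>x. T_ext f x + T_ext h x)"
  using assms by (simp add: T_ext_def fun_eq_iff distrib_left integrable_kernel_mult)

lemma T_ext_scale: "T_ext (\<lambda>x. c * f x) = (\<lambda>x. c * T_ext f x)"
proof -
  have "kernel x y * (c * f y) = c * (kernel x y * f y)" for x y by simp
  then show ?thesis by (simp only: T_ext_def fun_eq_iff integral_mult_right_zero) simp
qed

lemma T_ext_sum:
  assumes "finite J" "\<And>j. j \<in> J \<Longrightarrow> integrable \<nu> (a j)"
  shows "T_ext (\<lambda>x. \<Sum>j\<in>J. c j * a j x) x = (\<Sum>j\<in>J. c j * T_ext (a j) x)"
proof -
  have "T_ext (\<lambda>x. \<Sum>j\<in>J. c j * a j x) x = (\<integral>y. (\<Sum>j\<in>J. c j * (kernel x y * a j y)) \<partial>\<nu>)"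
    unfolding T_ext_def by (simp add: sum_distrib_left mult_ac)
  also have "\<dots> = (\<Sum>j\<in>J. c j * T_ext (a j) x)"
    using assms by (simp add: integrable_kernel_mult T_ext_def)
  finally show ?thesis .
qed

lemma T_ext_pointwise_bound:
  assumes "integrable \<nu> f"
  shows "cmod (T_ext f x) \<le> S x * L1_norm \<nu> f"
proof -
  have "cmod (T_ext f x) \<le> (\<integral>y. cmod (kernel x y * f y) \<partial>\<nu>)"
    unfolding T_ext_def by (rule integral_norm_bound)
  also have "\<dots> \<le> (\<integral>y. S x * cmod (f y) \<partial>\<nu>)"
  proof (rule integral_mono)
    show "integrable \<nu> (\<lambda>y. cmod (kernel x y * f y))"
      using assms by (intro integrable_norm integrable_kernel_mult)
    show "cmod (kernel x y * f y) \<le> S x * cmod (f y)" for y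
      using kernel_bounded by (simp add: norm_mult mult_right_mono)
  qed (use assms in simp)
  finally show ?thesis by (simp add: L1_norm_def)
qed

lemma T_ext_finite_support:
  assumes "finite F" "\<And>x. x \<notin> F \<Longrightarrow> f x = 0"
  shows "T_ext f x = T f x"
proof -
  have "T f x = (\<Sum>y\<in>F. w y *\<^sub>R (kernel x y * f y))"
    using assms by (rule T_finite_support)
  also have "\<dots> = T_ext f x"
    unfolding T_ext_def using assms by (intro integral_\<nu>_finite[symmetric]) auto
  finally show ?thesis by simp
qed

text \<open>Both sides agree on functions of finite support. The remainder of \<open>f\<close> outside a large finite
set is small in \<open>L\<^sup>1\<close> and in \<open>L\<^sup>2\<close>; the former controls the extension
pointwise, through the bounded row, and the latter controls \<open>T\<close>.\<close>

lemma T_ext_eq: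
  assumes L1: "integrable \<nu> f" and L2: "f \<in> L2_space \<nu>"
  shows "T_ext f = T f"
proof
  fix x
  obtain F :: "nat \<Rightarrow> 'v set"
    where F: "\<And>n. finite (F n)" "\<And>y. \<forall>\<^sub>F n in sequentially. y \<in> F n"
    using finite_exhaustion by blast
  define f1 where "f1 n = (\<lambda>y. f y * indicator (F n) y)" for n
  define f2 where "f2 n = (\<lambda>y. f y * indicator (- F n) y)" for n
  have f1_L2: "f1 n \<in> L2_space \<nu>" and f2_L2: "f2 n \<in> L2_space \<nu>" for n
    unfolding f1_def f2_def using L2 by (auto intro: restrict_L2)
  have f2_L1: "integrable \<nu> (f2 n)" for n
    unfolding f2_def using L1
    by (rule Bochner_Integration.integrable_bound) (auto split: split_indicator)
  have f1_L1: "integrable \<nu> (f1 n)" for n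
    unfolding f1_def using L1
    by (rule Bochner_Integration.integrable_bound) (auto split: split_indicator)
  have split: "f = (\<lambda>y. f1 n y + f2 n y)" for n
    by (auto simp: f1_def f2_def split: split_indicator)
  have f2_lim: "(\<lambda>n. f2 n y) \<longlonglongrightarrow> 0" for y
  proof (rule tendsto_eventually)
    show "\<forall>\<^sub>F n in sequentially. f2 n y = 0"
      using F(2)[of y] by eventually_elim (simp add: f2_def)
  qed
  have "(\<lambda>n. L1_norm \<nu> (f2 n)) \<longlonglongrightarrow> (\<integral>y. 0 \<partial>\<nu>)"
    unfolding L1_norm_def
  proof (rule integral_dominated_convergence[where w = "\<lambda>y. cmod (f y)"])
    show "AE y in \<nu>. (\<lambda>n. cmod (f2 n y)) \<longlonglongrightarrow> 0"
      using f2_lim by (simp add: tendsto_norm_zero)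
  qed (use L1 in \<open>auto simp: f2_def split: split_indicator\<close>)
  then have lim1: "(\<lambda>n. S x * L1_norm \<nu> (f2 n)) \<longlonglongrightarrow> 0"
    by (auto intro: tendsto_mult_right_zero)
  have "(\<lambda>n. \<integral>y. (cmod (f2 n y))\<^sup>2 \<partial>\<nu>) \<longlonglongrightarrow> (\<integral>y. 0 \<partial>\<nu>)"
  proof (rule integral_dominated_convergence[where w = "\<lambda>y. (cmod (f y))\<^sup>2"])
    have "(\<lambda>n. (cmod (f2 n y))\<^sup>2) \<longlonglongrightarrow> 0\<^sup>2" for y
      using f2_lim by (intro tendsto_power tendsto_norm_zero)
    then show "AE y in \<nu>. (\<lambda>n. (cmod (f2 n y))\<^sup>2) \<longlonglongrightarrow> 0" by simp
  qed (use L2 in \<open>auto simp: f2_def L2_space_iff split: split_indicator\<close>)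
  then have "(\<lambda>n. B\<^sup>2 * (L2_norm \<nu> (f2 n))\<^sup>2 / w x) \<longlonglongrightarrow> B\<^sup>2 * 0 / w x"
    by (intro tendsto_intros) (auto simp: L2_norm_def)
  then have lim2: "(\<lambda>n. sqrt (B\<^sup>2 * (L2_norm \<nu> (f2 n))\<^sup>2 / w x)) \<longlonglongrightarrow> 0"
    using tendsto_real_sqrt by fastforce
  have "cmod (T_ext f x - T f x) \<le> S x * L1_norm \<nu> (f2 n) + sqrt (B\<^sup>2 * (L2_norm \<nu> (f2 n))\<^sup>2 / w x)" for n
  proof -
    have "T_ext f x = T_ext (f1 n) x + T_ext (f2 n) x"
      using T_ext_add[OF f1_L1 f2_L1, of n n] split[of n] by metis
    moreover have "T f x = T (f1 n) x + T (f2 n) x"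
      using T_add[OF f1_L2 f2_L2, of n n] split[of n] by metis
    moreover have "T_ext (f1 n) x = T (f1 n) x"
      using F(1)[of n] by (rule T_ext_finite_support) (auto simp: f1_def)
    ultimately have "cmod (T_ext f x - T f x) \<le> cmod (T_ext (f2 n) x) + cmod (T (f2 n) x)"
      by (simp add: norm_triangle_ineq4)
    moreover have "cmod (T (f2 n) x) \<le> sqrt (B\<^sup>2 * (L2_norm \<nu> (f2 n))\<^sup>2 / w x)"
      using T_pointwise_bound[OF f2_L2, of x n] w_pos[of x]
      by (intro real_le_rsqrt) (simp add: pos_le_divide_eq power_mult_distrib mult.commute)
    ultimately show ?thesis using T_ext_pointwise_bound[OF f2_L1, of n x] by linarith
  qed
  then have "cmod (T_ext f x - T f x) \<le> 0"
    using tendsto_add[OF lim1 lim2] by (intro LIMSEQ_le_const) auto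
  then show "T_ext f x = T f x" by simp
qed

text \<open>The images of the partial sums converge pointwise, again since rows are bounded, so Fatou's lemma
carries their \<open>L\<^sup>1\<close> bound over to the limit.\<close>

lemma T_ext_series_bound:
  assumes f: "integrable \<nu> f" and a: "\<And>j. integrable \<nu> (a j)"
    and bound: "\<And>j. (\<integral>\<^sup>+x. ennreal (cmod (T_ext (a j) x)) \<partial>\<nu>) \<le> ennreal C" and C: "0 \<le> C"
    and c: "summable (\<lambda>j. cmod (c j))"
    and lim: "(\<lambda>n. L1_norm \<nu> (\<lambda>x. f x - (\<Sum>j<n. c j * a j x))) \<longlonglongrightarrow> 0"
  shows "(\<integral>\<^sup>+x. ennreal (cmod (T_ext f x)) \<partial>\<nu>) \<le> ennreal (C * (\<Sum>j. cmod (c j)))"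
proof -
  define s where "s n = (\<lambda>x. \<Sum>j<n. c j * a j x)" for n
  have s_int: "integrable \<nu> (s n)" for n unfolding s_def using a by simp
  have "(\<lambda>n. T_ext (s n) x) \<longlonglongrightarrow> T_ext f x" for x
  proof (rule LIM_zero_cancel, rule Lim_null_comparison)
    have "cmod (T_ext (s n) x - T_ext f x) \<le> S x * L1_norm \<nu> (\<lambda>x. f x - s n x)" for n
    proof -
      have "T_ext (\<lambda>y. (f y - s n y) + s n y) = (\<lambda>y. T_ext (\<lambda>y. f y - s n y) y + T_ext (s n) y)"
        using f s_int by (intro T_ext_add) auto
      then have "T_ext f x - T_ext (s n) x = T_ext (\<lambda>y. f y - s n y) x"
        by (simp add: fun_eq_iff)
      then show ?thesis
        using T_ext_pointwise_bound[of "\<lambda>y. f y - s n y" x] f s_int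
        by (simp add: norm_minus_commute)
    qed
    then show "\<forall>\<^sub>F n in sequentially. cmod (T_ext (s n) x - T_ext f x)
        \<le> S x * L1_norm \<nu> (\<lambda>x. f x - s n x)" by simp
    show "(\<lambda>n. S x * L1_norm \<nu> (\<lambda>x. f x - s n x)) \<longlonglongrightarrow> 0"
      using lim unfolding s_def by (rule tendsto_mult_right_zero)
  qed
  then have "ennreal (cmod (T_ext f x)) = liminf (\<lambda>n. ennreal (cmod (T_ext (s n) x)))" for x
    by (intro lim_imp_Liminf[symmetric] tendsto_ennrealI tendsto_norm) auto
  then have "(\<integral>\<^sup>+x. ennreal (cmod (T_ext f x)) \<partial>\<nu>)
      = (\<integral>\<^sup>+x. liminf (\<lambda>n. ennreal (cmod (T_ext (s n) x))) \<partial>\<nu>)" by simp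
  also have "\<dots> \<le> liminf (\<lambda>n. \<integral>\<^sup>+x. ennreal (cmod (T_ext (s n) x)) \<partial>\<nu>)"
    by (rule nn_integral_liminf) simp
  also have "\<dots> \<le> limsup (\<lambda>n. \<integral>\<^sup>+x. ennreal (cmod (T_ext (s n) x)) \<partial>\<nu>)"
    by (rule Liminf_le_Limsup) simp
  also have "\<dots> \<le> ennreal (C * (\<Sum>j. cmod (c j)))"
  proof (intro Limsup_bounded always_eventually allI)
    fix n
    have "(\<integral>\<^sup>+x. ennreal (cmod (T_ext (s n) x)) \<partial>\<nu>)
        \<le> (\<integral>\<^sup>+x. (\<Sum>j<n. ennreal (cmod (c j)) * ennreal (cmod (T_ext (a j) x))) \<partial>\<nu>)"
    proof (rule nn_integral_mono)
      fix x
      have "cmod (T_ext (s n) x) \<le> (\<Sum>j<n. cmod (c j) * cmod (T_ext (a j) x))"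
        unfolding s_def using T_ext_sum[of "{..<n}" a c x] a
        by (simp add: norm_mult[symmetric] norm_sum)
      then show "ennreal (cmod (T_ext (s n) x))
          \<le> (\<Sum>j<n. ennreal (cmod (c j)) * ennreal (cmod (T_ext (a j) x)))"
        by (simp add: ennreal_mult[symmetric] ennreal_leI del: ennreal_mult)
    qed
    also have "\<dots> = (\<Sum>j<n. ennreal (cmod (c j)) * (\<integral>\<^sup>+x. ennreal (cmod (T_ext (a j) x)) \<partial>\<nu>))"
      by (simp add: nn_integral_sum nn_integral_cmult)
    also have "\<dots> \<le> (\<Sum>j<n. ennreal (cmod (c j)) * ennreal C)"
      using bound by (intro sum_mono mult_left_mono) auto
    also have "\<dots> = ennreal (C * (\<Sum>j<n. cmod (c j)))"
      using C by (simp add: ennreal_mult[symmetric] sum_distrib_left mult.commute del: ennreal_mult)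
    also have "\<dots> \<le> ennreal (C * (\<Sum>j. cmod (c j)))"
      using C c by (intro ennreal_leI mult_left_mono sum_le_suminf) auto
    finally show "(\<integral>\<^sup>+x. ennreal (cmod (T_ext (s n) x)) \<partial>\<nu>) \<le> ennreal (C * (\<Sum>j. cmod (c j)))" .
  qed
  finally show ?thesis .
qed

end

section \<open>Calderon-Zygmund sets\<close>

context weighted_tree
begin

definition weight :: "'v \<Rightarrow> real" where
  "weight x = real q powi level x"

lemma weight_pos: "0 < weight x"
  using q_ge_2 by (simp add: weight_def zero_less_power_int)

sublocale weighted_points weight
  using weight_pos countable_vertices by unfold_locales auto

lemma \<mu>_eq: "\<mu> = \<nu>"
  by (simp add: \<mu>_def \<nu>_def weight_def)

lemma sum_weight_slice: "sum weight (slice n z) = weight z"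
proof -
  have "weight x = weight z / real q ^ n" if "x \<in> slice n z" for x
    using level_slice[OF that] q_ge_2 by (simp add: weight_def power_int_diff)
  then show ?thesis using card_slice[of n z] q_ge_2 by simp
qed

lemma sum_weight_slices:
  assumes "finite I"
  shows "sum weight (\<Union>n\<in>I. slice n z) = real (card I) * weight z"
proof -
  have "slice m z \<inter> slice n z = {}" if "m \<noteq> n" for m n
    using that level_slice[of _ m z] level_slice[of _ n z] by fastforce
  then have "sum weight (\<Union>n\<in>I. slice n z) = (\<Sum>n\<in>I. sum weight (slice n z))"
    using assms card_slice by (intro sum.UNION_disjoint) auto
  then show ?thesis by (simp add: sum_weight_slice)
qed

lemma envelope_Trapezoid_eq:
  "envelope (Trapezoid z h) = (\<Union>n\<in>{n. h \<le> 2 * n \<and> n < 4 * h}. slice n z)"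
proof (rule set_eqI)
  fix x
  have "below x z \<Longrightarrow> \<exists>n. level z - level x = int n"
    by (auto simp: below_iff_ancestor level_ancestor)
  then have "x \<in> envelope (Trapezoid z h) \<longleftrightarrow>
      (\<exists>n. below x z \<and> level z - level x = int n \<and> real h / 2 \<le> real n \<and> int n < 4 * int h)"
    by auto
  also have "\<dots> \<longleftrightarrow> (\<exists>n. x \<in> slice n z \<and> h \<le> 2 * n \<and> n < 4 * h)"
    unfolding below_iff_slice[symmetric] by (intro iff_exI) auto
  finally show "x \<in> envelope (Trapezoid z h) \<longleftrightarrow> x \<in> (\<Union>n\<in>{n. h \<le> 2 * n \<and> n < 4 * h}. slice n z)"
    by auto
qed

lemma slice_nonempty: "slice n z \<noteq> {}"
  using card_slice[of n z] q_ge_2 by auto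

lemma envelope_nonempty: "admissible R \<Longrightarrow> envelope R \<noteq> {}"
proof (cases R)
  case (Trapezoid z h)
  assume "admissible R"
  then have "h \<in> {n. h \<le> 2 * n \<and> n < 4 * h}" using Trapezoid by simp
  then have "slice h z \<subseteq> envelope R" unfolding Trapezoid envelope_Trapezoid_eq by blast
  then show ?thesis using slice_nonempty by blast
qed simp

lemma enlargementD:
  assumes "admissible R" "x \<in> enlargement R"
  shows "\<exists>y\<in>envelope R. real (d x y) < real (height R) / 4"
proof -
  have "Inf (d x ` envelope R) \<in> d x ` envelope R"
    using envelope_nonempty[OF assms(1)] by (intro Inf_nat_def1) auto
  then show ?thesis using assms(2) by (auto simp: enlargement_def)
qed

lemma envelope_subset_enlargement:
  assumes "admissible R" shows "envelope R \<subseteq> enlargement R"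
proof
  fix x assume "x \<in> envelope R"
  then have "(INF y\<in>envelope R. d x y) \<le> d x x" by (intro cINF_lower) auto
  then have "(INF y\<in>envelope R. d x y) = 0" by simp
  moreover have "0 < height R" using assms by (cases R) auto
  ultimately show "x \<in> enlargement R" by (simp add: enlargement_def)
qed

text \<open>From a vertex at depth \<open>n\<close> below \<open>z\<close>, one can leave the set of vertices below \<open>z\<close>
only through \<open>z\<close>, which takes more than \<open>n\<close> steps. The lower bound on \<open>k\<close> keeps the
induction going: it says that the top has not been reached too early.\<close>

lemma walk_to_slice_stays_below:
  assumes "(E ^^ m) x y" "y \<in> slice n z" "m \<le> n"
  shows "\<exists>k. x \<in> slice k z \<and> n \<le> k + m \<and> k \<le> n + m"
  using assms(1,3)
proof (induction m arbitrary: x)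
  case (Suc m)
  then obtain x' where x': "E x x'" "(E ^^ m) x' y" by (meson relpowp_Suc_D2)
  then obtain k where k: "x' \<in> slice k z" "n \<le> k + m" "k \<le> n + m"
    using Suc by auto
  then obtain j where j: "k = Suc j" using Suc.prems by (cases k) auto
  from x'(1) consider "x = parent x'" | "x' = parent x" by (auto simp: adjacent_iff_parent)
  then show ?case
  proof cases
    case 1
    then have "x \<in> slice j z" using k(1) by (simp add: slice_def j funpow_swap1)
    then show ?thesis using k j by auto
  next
    case 2
    then have "x \<in> slice (Suc k) z" using k(1) by (simp add: slice_def funpow_swap1)
    then show ?thesis using k by (intro exI[of _ "Suc k"]) auto
  qed
qed (use assms in auto)

text \<open>Points of the envelope have depth at least \<open>h / 2\<close>, so the enlargement by less than
\<open>h / 4\<close> stays below \<open>z\<close>, at depth less than \<open>4 * h + h / 4\<close>.\<close>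

lemma enlargement_subset_slices:
  assumes "1 \<le> h"
  shows "enlargement (Trapezoid z h) \<subseteq> (\<Union>n\<in>{..<5 * h}. slice n z)"
proof
  fix x assume "x \<in> enlargement (Trapezoid z h)"
  then obtain y where y: "y \<in> envelope (Trapezoid z h)" "real (d x y) < real h / 4"
    using enlargementD[of "Trapezoid z h" x] assms by auto
  then obtain n where n: "y \<in> slice n z" "h \<le> 2 * n" "n < 4 * h"
    unfolding envelope_Trapezoid_eq by auto
  then obtain k where "x \<in> slice k z" "k \<le> n + d x y"
    using walk_to_slice_stays_below[OF relpowp_gdist n(1), of x] y(2) by auto
  then show "x \<in> (\<Union>n\<in>{..<5 * h}. slice n z)" using n y(2) by auto
qed

lemma enlargement_Degenerate: "enlargement (Degenerate z) = {z}"
proof -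
  have "real (d x z) < 1 / 4 \<longleftrightarrow> x = z" for x
    using gdist_eq_0_iff[of x z] by (cases "d x z") auto
  then show ?thesis by (simp add: enlargement_def)
qed

lemma finite_enlargement:
  assumes "admissible R" shows "finite (enlargement R)"
proof (cases R)
  case (Trapezoid z h)
  then show ?thesis
    using assms card_slice finite_subset[OF enlargement_subset_slices[of h z]] by auto
qed (simp add: enlargement_Degenerate)

lemma finite_envelope: "admissible R \<Longrightarrow> finite (envelope R)"
  using envelope_subset_enlargement finite_enlargement finite_subset by blast

text \<open>Counting slices: the enlargement meets at most \<open>5 * h\<close> of them, and the envelope
contains at least the \<open>3 * h\<close> slices at depths from \<open>h\<close> to \<open>4 * h - 1\<close>.\<close>

lemma measure_enlargement_le:
  assumes "admissible R"
  shows "measure \<nu> (enlargement R) \<le> 2 * measure \<nu> (envelope R)"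
proof (cases R)
  case (Degenerate z)
  then show ?thesis by (simp add: enlargement_Degenerate)
next
  case (Trapezoid z h)
  have h: "1 \<le> h" using assms Trapezoid by simp
  have "measure \<nu> (enlargement R) \<le> sum weight (\<Union>n\<in>{..<5 * h}. slice n z)"
    using enlargement_subset_slices[OF h, of z] finite_enlargement[OF assms] Trapezoid card_slice
    by (auto simp: measure_\<nu>_finite intro!: sum_mono2)
  also have "\<dots> = 5 * real h * weight z" by (simp add: sum_weight_slices)
  also have "\<dots> \<le> 2 * (3 * real h * weight z)" by simp
  also have "3 * real h * weight z = sum weight (\<Union>n\<in>{h..<4 * h}. slice n z)"
    by (simp add: sum_weight_slices)
  also have "2 * \<dots> \<le> 2 * measure \<nu> (envelope R)"
    using finite_envelope[OF assms] Trapezoid envelope_Trapezoid_eq[of z h]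
    by (auto simp: measure_\<nu>_finite intro!: sum_mono2)
  finally show ?thesis by simp
qed

lemma hoermander_integral_le:
  assumes "admissible R" "y \<in> envelope R" "z \<in> envelope R"
  shows "(\<integral>\<^sup>+x\<in>- enlargement R. ennreal (cmod (K x y - K x z)) \<partial>\<nu>) \<le> hoermander_sup K"
  unfolding hoermander_sup_def \<mu>_eq
  using assms by (intro SUP_upper2[of R] SUP_upper2[of "(y, z)"]) auto

lemma hoermander_pointwise:
  assumes H: "hoermander_sup K \<le> ennreal H" "0 \<le> H"
    and R: "admissible R" "y \<in> envelope R" "z \<in> envelope R" "x \<notin> enlargement R"
  shows "cmod (K x y - K x z) \<le> H / weight x"
proof -
  have "ennreal (weight x * cmod (K x y - K x z))
      = ennreal (weight x) * (ennreal (cmod (K x y - K x z)) * indicator (- enlargement R) x)"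
    using R by (simp add: ennreal_mult)
  also have "\<dots> \<le> ennreal H"
    using point_le_nn_integral hoermander_integral_le[OF R(1-3), of K] H(1) by (rule order_trans[OF _ order_trans])
  finally show ?thesis
    using H weight_pos[of x] by (simp add: pos_le_divide_eq mult.commute)
qed

text \<open>Distance dominates difference of levels, and all points of the envelope are at least
\<open>h / 2\<close> levels lower than \<open>z\<close>.\<close>

lemma same_level_not_in_enlargement:
  assumes "level x = level z" "1 \<le> h"
  shows "x \<notin> enlargement (Trapezoid z h)"
proof
  assume "x \<in> enlargement (Trapezoid z h)"
  then obtain y where y: "y \<in> envelope (Trapezoid z h)" "real (d x y) < real h / 4"
    using enlargementD[of "Trapezoid z h" x] assms by auto
  then obtain n where n: "y \<in> slice n z" "h \<le> 2 * n"
    unfolding envelope_Trapezoid_eq by auto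
  have "level x \<le> level y + int (d x y)" using level_le_gdist[of x y] by (simp add: gdist_commute)
  then have "n \<le> d x y" using level_slice[OF n(1)] assms by linarith
  then show False using y(2) n(2) by linarith
qed

section \<open>Boundedness of the rows of the matrix\<close>

text \<open>The rows are not only square integrable but bounded. Where \<open>y\<close> is at least as high as
\<open>x\<close>, the mass of \<open>y\<close> is at least that of \<open>x\<close> and the \<open>L\<^sup>2\<close> bound
suffices. For lower \<open>y\<close> masses degenerate, but the ancestor \<open>z\<close> of \<open>y\<close> at the level
of \<open>x\<close> heads a slice through \<open>y\<close> whose total mass is that of \<open>x\<close>. By the
\<open>L\<^sup>2\<close> bound the row is at most \<open>B / weight x\<close> at some \<open>u\<close> in this slice, and
the integral condition, read off at the single point \<open>x\<close>, bounds the difference between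
\<open>y\<close> and \<open>u\<close>.\<close>

lemma kernel_bounded:
  assumes T: "L2_bounded_operator weight T B"
    and K: "admits_kernel_off_diagonal \<nu> T K"
    and H: "hoermander_sup K \<le> ennreal H" "0 \<le> H"
  shows "cmod (L2_bounded_operator.kernel weight T x y) \<le> (B + H) / weight x"
proof -
  interpret L2_bounded_operator weight T B by (rule T)
  have le: "r \<le> B / weight x" if "weight x * r\<^sup>2 \<le> B\<^sup>2 / weight x" for r
  proof (rule power2_le_imp_le)
    have "r\<^sup>2 \<le> B\<^sup>2 / weight x / weight x"
      using that weight_pos[of x] by (simp add: pos_le_divide_eq mult_ac)
    then show "r\<^sup>2 \<le> (B / weight x)\<^sup>2" by (simp add: power2_eq_square)
    show "0 \<le> B / weight x" using B_nonneg by simp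
  qed
  show ?thesis
  proof (cases "level x \<le> level y")
    case True
    then have "weight x \<le> weight y"
      using q_ge_2 by (simp add: weight_def power_int_increasing)
    then have "weight x * (cmod (kernel x y))\<^sup>2 \<le> weight y * (cmod (kernel x y))\<^sup>2"
      by (intro mult_right_mono) auto
    also have "\<dots> \<le> B\<^sup>2 / weight x" using kernel_row_L2[of "{y}" x] by simp
    finally have "cmod (kernel x y) \<le> B / weight x" by (rule le)
    also have "\<dots> \<le> (B + H) / weight x" using H by (simp add: divide_right_mono)
    finally show ?thesis .
  next
    case False
    \<comment> \<open>The slice lies in the envelope of the trapezoid with top \<open>z\<close> and height \<open>n\<close>,
      whose enlargement avoids \<open>x\<close>.\<close>
    define n where "n = nat (level x - level y)"
    define z where "z = ancestor n y"
    define A where "A = slice n z"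
    have n: "1 \<le> n" and z: "level x = level z"
      using False by (auto simp: n_def z_def level_ancestor)
    have y: "y \<in> A" by (simp add: A_def z_def slice_def)
    have A_sub: "A \<subseteq> envelope (Trapezoid z n)"
      using n UN_upper[of n "{k. n \<le> 2 * k \<and> k < 4 * n}" "\<lambda>k. slice k z"]
      unfolding envelope_Trapezoid_eq A_def by simp
    have A_level: "level u < level x" if "u \<in> A" for u
      using that level_slice[of u n z] n z by (auto simp: A_def)
    have weight_xz: "weight x = weight z" using z by (simp add: weight_def)
    have "\<exists>u\<in>A. weight x * (cmod (kernel x u))\<^sup>2 \<le> B\<^sup>2 / weight x"
    proof (rule ccontr)
      assume "\<not> ?thesis"
      then have "(\<Sum>u\<in>A. weight u * (B\<^sup>2 / weight x)) < (\<Sum>u\<in>A. weight u * (weight x * (cmod (kernel x u))\<^sup>2))"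
        using card_slice[of n z] y weight_pos
        by (intro sum_strict_mono mult_strict_left_mono) (auto simp: A_def not_le)
      moreover have "(\<Sum>u\<in>A. weight u * (B\<^sup>2 / weight x)) = weight x * (B\<^sup>2 / weight x)"
        unfolding sum_distrib_right[symmetric] A_def sum_weight_slice weight_xz ..
      moreover have "(\<Sum>u\<in>A. weight u * (weight x * (cmod (kernel x u))\<^sup>2))
          = weight x * (\<Sum>u\<in>A. weight u * (cmod (kernel x u))\<^sup>2)"
        unfolding sum_distrib_left by (intro sum.cong) (simp_all add: mult_ac)
      ultimately have "weight x * (B\<^sup>2 / weight x) < weight x * (\<Sum>u\<in>A. weight u * (cmod (kernel x u))\<^sup>2)"
        by simp
      also have "\<dots> \<le> weight x * (B\<^sup>2 / weight x)"
        using kernel_row_L2[of A x] card_slice[of n z] by (intro mult_left_mono) (auto simp: A_def)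
      finally show False by simp
    qed
    then obtain u where u: "u \<in> A" "cmod (kernel x u) \<le> B / weight x" using le by blast
    have "cmod (K x y - K x u) \<le> H / weight x"
      using A_sub y u n z by (intro hoermander_pointwise[OF H, of "Trapezoid z n"]
          same_level_not_in_enlargement) auto
    moreover have "K x y = kernel x y" "K x u = kernel x u"
      using kernel_eq_off_diagonal[OF K] A_level y u(1) by (metis less_irrefl)+
    ultimately have "cmod (kernel x y) \<le> B / weight x + H / weight x"
      using u(2) norm_triangle_sub[of "kernel x y" "kernel x u"] by simp
    then show ?thesis by (simp add: add_divide_distrib)
  qed
qed

section \<open>The extension to the Hardy space\<close>

lemma bounded_extension:
  assumes T: "bounded_operator (L2_space \<nu>) (L2_norm \<nu>) (L2_space \<nu>) (L2_norm \<nu>) T"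
    and K: "admits_kernel_off_diagonal \<nu> T K"
    and K_hoermander: "hoermander_sup K < \<infinity>"
  shows "\<exists>T'. bounded_operator H1_space H1_norm (L1_space \<nu>) (L1_norm \<nu>) T'
            \<and> (\<forall>f \<in> H1_space \<inter> L2_space \<nu>. T' f = T f)"
proof -
  obtain B0 where B0: "L2_norm \<nu> (T f) \<le> B0 * L2_norm \<nu> f" if "f \<in> L2_space \<nu>" for f
    using T unfolding bounded_operator_def by blast
  define B where "B = \<bar>B0\<bar>"
  have B: "L2_norm \<nu> (T f) \<le> B * L2_norm \<nu> f" if "f \<in> L2_space \<nu>" for f
    using B0[OF that] mult_right_mono[OF abs_ge_self[of B0] L2_norm_nonneg[of f]]
    by (simp add: B_def)
  have op: "L2_bounded_operator weight T B"
    using T B unfolding bounded_operator_def by unfold_locales (auto simp: B_def)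
  define H where "H = enn2real (hoermander_sup K)"
  have H: "hoermander_sup K \<le> ennreal H" "0 \<le> H"
    using K_hoermander by (auto simp: H_def)
  interpret L2_bounded_operator weight T B by (rule op)
  interpret L2_operator_bounded_kernel weight T B "\<lambda>x. (B + H) / weight x"
    by unfold_locales (rule kernel_bounded[OF op K H])
  define C where "C = B * sqrt 2 + H"
  have C: "0 \<le> C" using H B_nonneg by (simp add: C_def)
  have H1_integrable: "integrable \<nu> f" if "f \<in> H1_space" for f
    using that by (simp add: H1_space_def L1_space_def \<mu>_eq)
  have atom: "integrable \<nu> a \<and> (\<integral>\<^sup>+x. ennreal (cmod (T_ext a x)) \<partial>\<nu>) \<le> ennreal C"
    if a: "atom a" for a
  proof -
    obtain R where R: "admissible R" "\<forall>x. x \<notin> envelope R \<longrightarrow> a x = 0"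
      "AE x in \<nu>. cmod (a x) \<le> 1 / measure \<nu> (envelope R)" "(\<integral>x. a x \<partial>\<nu>) = 0"
      using a unfolding atom_def \<mu>_eq by blast
    have a_support: "a x = 0" if "x \<notin> envelope R" for x using R(2) that by blast
    have "integrable \<nu> a" using finite_envelope[OF R(1)] a_support by (rule integrable_\<nu>_finite)
    moreover have "T_ext a = T a"
      using T_ext_finite_support[of "envelope R" a] finite_envelope[OF R(1)] a_support by blast
    moreover have "(\<integral>\<^sup>+x. ennreal (cmod (T a x)) \<partial>\<nu>) \<le> ennreal C"
      unfolding C_def
    proof (rule atom_image_bound[OF K finite_enlargement[OF R(1)]
          envelope_subset_enlargement[OF R(1)] envelope_nonempty[OF R(1)]
          measure_enlargement_le[OF R(1)] a_support])
      show "cmod (a x) \<le> 1 / measure \<nu> (envelope R)" for x using R(3) by (simp add: AE_\<nu>_iff)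
      show "(\<integral>\<^sup>+x\<in>- enlargement R. ennreal (cmod (K x y - K x z)) \<partial>\<nu>) \<le> ennreal H"
        if "y \<in> envelope R" "z \<in> envelope R" for y z
        using hoermander_integral_le[OF R(1) that] H(1) by (rule order_trans)
    qed (use R H in auto)
    ultimately show ?thesis by simp
  qed
  have bound: "(\<integral>\<^sup>+x. ennreal (cmod (T_ext f x)) \<partial>\<nu>) \<le> ennreal (C * (\<Sum>j. cmod (c j)))"
    if "f \<in> H1_space" "atomic_decomposition f c a" for f c a
  proof (rule T_ext_series_bound[where a = a])
    have ca: "\<forall>j. atom (a j)" "summable (\<lambda>j. cmod (c j))"
      "(\<lambda>n. L1_norm \<nu> (\<lambda>x. f x - (\<Sum>j<n. c j * a j x))) \<longlonglongrightarrow> 0"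
      using that(2) unfolding atomic_decomposition_def \<mu>_eq by auto
    show "integrable \<nu> f" using that(1) by (rule H1_integrable)
    show "integrable \<nu> (a j)"
      "(\<integral>\<^sup>+x. ennreal (cmod (T_ext (a j) x)) \<partial>\<nu>) \<le> ennreal C" for j
      using atom ca(1) by auto
    show "0 \<le> C" by (rule C)
    show "summable (\<lambda>j. cmod (c j))" by (rule ca(2))
    show "(\<lambda>n. L1_norm \<nu> (\<lambda>x. f x - (\<Sum>j<n. c j * a j x))) \<longlonglongrightarrow> 0" by (rule ca(3))
  qed
  have image: "integrable \<nu> (T_ext f)" if f: "f \<in> H1_space" for f
  proof (rule integrableI_bounded)
    obtain c a where "atomic_decomposition f c a" using f by (auto simp: H1_space_def)
    from bound[OF f this]
    show "(\<integral>\<^sup>+x. ennreal (norm (T_ext f x)) \<partial>\<nu>) < \<infinity>"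
      by (rule order.strict_trans1) simp
  qed simp
  \<comment> \<open>The factor is \<open>C + 1\<close> rather than \<open>C\<close> so that one can divide by it.\<close>
  have norm_bound: "L1_norm \<nu> (T_ext f) \<le> (C + 1) * H1_norm f" if f: "f \<in> H1_space" for f
  proof -
    have "L1_norm \<nu> (T_ext f) / (C + 1) \<le> H1_norm f"
      unfolding H1_norm_def
    proof (rule cInf_greatest)
      show "{(\<Sum>j. cmod (c j)) |c a. atomic_decomposition f c a} \<noteq> {}"
        using f by (auto simp: H1_space_def)
      fix r assume "r \<in> {(\<Sum>j. cmod (c j)) |c a. atomic_decomposition f c a}"
      then obtain c a where r: "r = (\<Sum>j. cmod (c j))" and ca: "atomic_decomposition f c a" by blast
      have "0 \<le> r"
        unfolding r using ca by (intro suminf_nonneg) (auto simp: atomic_decomposition_def)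
      have "ennreal (L1_norm \<nu> (T_ext f)) = (\<integral>\<^sup>+x. ennreal (cmod (T_ext f x)) \<partial>\<nu>)"
        unfolding L1_norm_def using image[OF f] by (intro nn_integral_eq_integral[symmetric]) auto
      also have "\<dots> \<le> ennreal (C * r)" unfolding r by (rule bound[OF f ca])
      finally have "L1_norm \<nu> (T_ext f) \<le> C * r" using C \<open>0 \<le> r\<close> by simp
      also have "\<dots> \<le> (C + 1) * r" using \<open>0 \<le> r\<close> by (simp add: distrib_right)
      finally show "L1_norm \<nu> (T_ext f) / (C + 1) \<le> r"
        using C by (simp add: pos_divide_le_eq mult.commute)
    qed
    then show ?thesis using C by (simp add: pos_divide_le_eq mult.commute)
  qed
  have "bounded_operator H1_space H1_norm (L1_space \<nu>) (L1_norm \<nu>) T_ext"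
    unfolding bounded_operator_def
    using image norm_bound H1_integrable T_ext_add T_ext_scale by (auto simp: L1_space_def)
  moreover have "\<forall>f \<in> H1_space \<inter> L2_space \<nu>. T_ext f = T f"
    using H1_integrable T_ext_eq by blast
  ultimately show ?thesis by blast
qed

end

theorem theorem4p7:
  fixes E :: "'v \<Rightarrow> 'v \<Rightarrow> bool" and q :: nat and g :: "'v set" and N :: "'v \<Rightarrow> int"
    and T :: "('v \<Rightarrow> complex) \<Rightarrow> ('v \<Rightarrow> complex)"
    and K :: "'v \<Rightarrow> 'v \<Rightarrow> complex"
  defines "M \<equiv> weighted_tree.\<mu> E q g N"
  assumes "weighted_tree E q g N"
    and "bounded_operator (L2_space M) (L2_norm M) (L2_space M) (L2_norm M) T"
    and "locally_integrable_off_diagonal M K"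
    and "admits_kernel_off_diagonal M T K"
    and "weighted_tree.hoermander_sup E q g N K < \<infinity>"
  shows "\<exists>T'. bounded_operator (weighted_tree.H1_space E q g N) (weighted_tree.H1_norm E q g N)
                (L1_space M) (L1_norm M) T'
            \<and> (\<forall>f \<in> weighted_tree.H1_space E q g N \<inter> L2_space M. T' f = T f)"
proof -
  interpret weighted_tree E q g N by (rule assms)
  show ?thesis
    using assms(3,5,6) unfolding M_def \<mu>_eq by (rule bounded_extension)
qed

end
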